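(* Let $A,B$ be twisted complexes, and let $\widetilde d^A,\widetilde d^B$ be the square-zero coderivations of bidegree $(0,1)$ on $\mathcal D^{¡}(A)$ and $\mathcal D^{¡}(B)$ respectively encoding the twisted complex structures of $A$ and $B$. Let $f,g:A\to B$ be morphisms of twisted complexes, with corresponding $\mathcal D^{¡}$-coalgebra maps $\widetilde F,\widetilde G:\mathcal D^{¡}(A)\to\mathcal D^{¡}(B)$ of bidegree $(0,0)$, and let $r\ge0$. Then having an $r$-homotopy $h$ from $f$ to $g$ is equivalent to having a $\mathcal D^{¡}$-coalgebra map $\widetilde H:\mathcal D^{¡}(A)\to\mathcal D^{¡}(B)$ of bidegree $(r,r-1)$ such that $$(-1)^r\widetilde d^B\widetilde H+\widetilde H\widetilde d^A=\mathbb S^r\widetilde G-\mathbb S^r\widetilde F.$$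
   Context: $R$ is a commutative ring with unit. A bigraded module $A=\{A_i^j\}$ is a $(\mathbb Z,\mathbb Z)$-bigraded $R$-module; a map of bidegree $(p,q)$ sends $A_i^j$ to $A_{i+p}^{j+q}$. Twisted complexes: $(A,d_m)$ is a bigraded module $A$ with maps $d_m:A\to A$, $m\ge 0$, of bidegree $(-m,-m+1)$ such that $\sum_{i+j=m}(-1)^i d_id_j=0$ for all $m\ge0$. A morphism $f:(A,d^A_m)\to(B,d^B_m)$ is a family $f_m:A\to B$, $m\ge0$, of bidegree $(-m,-m)$ with $\sum_{i+j=m}d_i^Bf_j=\sum_{i+j=m}(-1)^if_id_j^A$ for all $m\geq 0$. Composition is $(g\circ f)_m=\sum_{i+j=m}g_if_j$. The $r$-path of $(B,d_m)$ is the twisted complex $P_r(B)_i^j:=B_i^j\oplus B_{i+r}^{j+r-1}\oplus B_i^j$ with $D_r(x,y,z)=(d_rx,-x-d_ry+z,d_rz)$ and $D_m(x,y,z)=(d_mx,(-1)^{m+r+1}d_my,d_mz)$ for $m\ne r$. An $r$-homotopy from $f$ to $g$ ($f,g:A\to B$) is a morphism of twisted complexes $h:A\to P_r(B)$ with $\partial^-h=f$, $\partial^+h=g$, where $\partial^-(x,y,z)=x$, $\partial^+(x,y,z)=z$ are strict morphisms $P_r(B)\to B$ (only the component of index $0$ is nonzero). $\mathcal D^{¡}$-coalgebras: $\mathcal D^{¡}=R[x]$ with $x$ of bidegree $(-1,-1)$ and $\Delta(x^n)=\sum_{i+j=n}x^i\otimes x^j$. A $\mathcal D^{¡}$-coalgebra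 is a pair $(C,f_C)$ with $f_C:C\to C$ linear of bidegree $(1,1)$. The cofree one on a bigraded module $A$ is $\mathcal D^{¡}(A)=R[x]\otimes A$ with map $d_x^A(x^i\otimes a)=x^{i-1}\otimes a$ (zero if $i=0$). A map of $\mathcal D^{¡}$-coalgebras $h:(C,f_C)\to(D,f_D)$ of bidegree $(u,v)$ is a bigraded map of bidegree $(u,v)$ with $f_Dh=(-1)^{u+v}hf_C$. A coderivation of $(C,f_C)$ of bidegree $(s,t)$ is a linear map $d:C\to C$ of bidegree $(s,t)$ with $df_C=(-1)^{s+t}f_Cd$. Correspondence: a family $f=(f_n)_{n\ge0}$ of maps $f_n:A\to B$ of bidegree $(u-n,v-n)$ corresponds bijectively to the $\mathcal D^{¡}$-coalgebra map $\widetilde F:\mathcal D^{¡}(A)\to\mathcal D^{¡}(B)$ of bidegree $(u,v)$ given by $\widetilde F(x^n\otimes a)=\sum_{i=0}^n(-1)^{i(u+v)}x^i\otimes f_{n-i}(a)$. The coderivation $\widetilde d^A$ encoding the twisted complex $(A,d_m)$ is the map corresponding in this way to the family $(d_n)_{n}$ (with $(u,v)=(0,1)$), and $\widetilde F,\widetilde G$ correspond to the families $f,g$ (with $(u,v)=(0,0)$). Shift: $\mathbb S(f_0,f_1,\dots):=(0,f_0,f_1,\dots)$, which increases bidegree by $(1,1)$; on corresponding coalgebra maps, $\mathbb S\widetilde F=\widetilde F d_x^A$. $\mathbb S^r$ is the $r$-th iterate. *)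

theory Defs
  imports "HOL-Algebra.Module"
begin

section \<open>Bigraded modules and bigraded maps\<close>

text \<open>
  A bigraded module \<open>A = {A_i^j}\<close> is an external family: \<open>A i j\<close> is the module \<open>A_i^j\<close>. All the
  \<open>A i j\<close> have their elements in one type, but they need not share carriers, zeros or operations.
  A map of bidegree \<open>(p, q)\<close> is a family of functions; \<open>f i j\<close> is its restriction to \<open>A_i^j\<close>, and
  only its values on the carrier of \<open>A i j\<close> are relevant.
\<close>

definition bigraded_module ::
  "('r, 'k) ring_scheme \<Rightarrow> (int \<Rightarrow> int \<Rightarrow> ('r, 'a, 'm) module_scheme) \<Rightarrow> bool" where
  "bigraded_module R A \<longleftrightarrow> (\<forall>i j. module R (A i j))"

definition linear_hom ::
  "('r, 'k) ring_scheme \<Rightarrow> ('r, 'a, 'm) module_scheme \<Rightarrow> ('r, 'b, 'n) module_scheme \<Rightarrow> ('a \<Rightarrow> 'b) \<Rightarrow> bool"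
  where
  "linear_hom R M N f \<longleftrightarrow>
     f \<in> carrier M \<rightarrow> carrier N \<and>
     (\<forall>x\<in>carrier M. \<forall>y\<in>carrier M. f (x \<oplus>\<^bsub>M\<^esub> y) = f x \<oplus>\<^bsub>N\<^esub> f y) \<and>
     (\<forall>a\<in>carrier R. \<forall>x\<in>carrier M. f (a \<odot>\<^bsub>M\<^esub> x) = a \<odot>\<^bsub>N\<^esub> f x)"

definition bigraded_map ::
  "('r, 'k) ring_scheme \<Rightarrow> int \<Rightarrow> int \<Rightarrow> (int \<Rightarrow> int \<Rightarrow> ('r, 'a, 'm) module_scheme) \<Rightarrow>
   (int \<Rightarrow> int \<Rightarrow> ('r, 'b, 'n) module_scheme) \<Rightarrow> (int \<Rightarrow> int \<Rightarrow> 'a \<Rightarrow> 'b) \<Rightarrow> bool" where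
  "bigraded_map R p q A B f \<longleftrightarrow> (\<forall>i j. linear_hom R (A i j) (B (i + p) (j + q)) (f i j))"

text \<open>\<open>g \<circ> f\<close>, where \<open>(p, q)\<close> is the bidegree of the inner map \<open>f\<close>.\<close>

definition bicomp ::
  "int \<Rightarrow> int \<Rightarrow> (int \<Rightarrow> int \<Rightarrow> 'b \<Rightarrow> 'c) \<Rightarrow> (int \<Rightarrow> int \<Rightarrow> 'a \<Rightarrow> 'b) \<Rightarrow> (int \<Rightarrow> int \<Rightarrow> 'a \<Rightarrow> 'c)" where
  "bicomp p q g f i j x = g (i + p) (j + q) (f i j x)"

text \<open>\<open>(-1)^k x\<close> in the module \<open>M\<close>.\<close>

definition signed :: "('r, 'a, 'm) module_scheme \<Rightarrow> int \<Rightarrow> 'a \<Rightarrow> 'a" where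
  "signed M k x = (if even k then x else \<ominus>\<^bsub>M\<^esub> x)"


section \<open>Twisted complexes\<close>

text \<open>A sum over \<open>i + j = m\<close> is written as a sum over \<open>k \<le> m\<close> with \<open>i = k\<close> and \<open>j = m - k\<close>.\<close>

definition twisted_complex ::
  "('r, 'k) ring_scheme \<Rightarrow> (int \<Rightarrow> int \<Rightarrow> ('r, 'a, 'm) module_scheme) \<Rightarrow>
   (nat \<Rightarrow> int \<Rightarrow> int \<Rightarrow> 'a \<Rightarrow> 'a) \<Rightarrow> bool" where
  "twisted_complex R A d \<longleftrightarrow>
     bigraded_module R A \<and>
     (\<forall>m. bigraded_map R (- int m) (1 - int m) A A (d m)) \<and>
     (\<forall>m i j. \<forall>x\<in>carrier (A i j).
        (let M = A (i - int m) (j - int m + 2) in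
         (\<Oplus>\<^bsub>M\<^esub>k\<in>{..m}. signed M (int k)
            (bicomp (- int (m - k)) (1 - int (m - k)) (d k) (d (m - k)) i j x)) = \<zero>\<^bsub>M\<^esub>))"

text \<open>\<open>f\<close> is a morphism from \<open>(A, dA)\<close> to \<open>(B, dB)\<close>.\<close>

definition twisted_morphism ::
  "('r, 'k) ring_scheme \<Rightarrow>
   (int \<Rightarrow> int \<Rightarrow> ('r, 'a, 'm) module_scheme) \<Rightarrow> (nat \<Rightarrow> int \<Rightarrow> int \<Rightarrow> 'a \<Rightarrow> 'a) \<Rightarrow>
   (int \<Rightarrow> int \<Rightarrow> ('r, 'b, 'n) module_scheme) \<Rightarrow> (nat \<Rightarrow> int \<Rightarrow> int \<Rightarrow> 'b \<Rightarrow> 'b) \<Rightarrow>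
   (nat \<Rightarrow> int \<Rightarrow> int \<Rightarrow> 'a \<Rightarrow> 'b) \<Rightarrow> bool" where
  "twisted_morphism R A dA B dB f \<longleftrightarrow>
     (\<forall>m. bigraded_map R (- int m) (- int m) A B (f m)) \<and>
     (\<forall>m i j. \<forall>x\<in>carrier (A i j).
        (let M = B (i - int m) (j - int m + 1) in
         (\<Oplus>\<^bsub>M\<^esub>k\<in>{..m}. bicomp (- int (m - k)) (- int (m - k)) (dB k) (f (m - k)) i j x) =
         (\<Oplus>\<^bsub>M\<^esub>k\<in>{..m}. signed M (int k)
            (bicomp (- int (m - k)) (1 - int (m - k)) (f k) (dA (m - k)) i j x))))"

text \<open>The composite \<open>g \<circ> f\<close> of morphisms, where \<open>C\<close> is the target of \<open>g\<close>.\<close>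

definition twisted_comp ::
  "(int \<Rightarrow> int \<Rightarrow> ('r, 'c, 'm) module_scheme) \<Rightarrow> (nat \<Rightarrow> int \<Rightarrow> int \<Rightarrow> 'b \<Rightarrow> 'c) \<Rightarrow>
   (nat \<Rightarrow> int \<Rightarrow> int \<Rightarrow> 'a \<Rightarrow> 'b) \<Rightarrow> (nat \<Rightarrow> int \<Rightarrow> int \<Rightarrow> 'a \<Rightarrow> 'c)" where
  "twisted_comp C g f m i j x =
     (\<Oplus>\<^bsub>C (i - int m) (j - int m)\<^esub>k\<in>{..m}.
        bicomp (- int (m - k)) (- int (m - k)) (g k) (f (m - k)) i j x)"

definition family_eq ::
  "(int \<Rightarrow> int \<Rightarrow> ('r, 'a, 'm) module_scheme) \<Rightarrow> (nat \<Rightarrow> int \<Rightarrow> int \<Rightarrow> 'a \<Rightarrow> 'b) \<Rightarrow>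
   (nat \<Rightarrow> int \<Rightarrow> int \<Rightarrow> 'a \<Rightarrow> 'b) \<Rightarrow> bool" where
  "family_eq A f g \<longleftrightarrow> (\<forall>m i j. \<forall>x\<in>carrier (A i j). f m i j x = g m i j x)"


section \<open>Paths and homotopies\<close>

text \<open>Binary direct sum. The ring multiplication and unit that a \<^typ>\<open>('r, 'a) module\<close> record
  inherits play no role in \<^locale>\<open>module\<close>.\<close>

definition direct_sum ::
  "('r, 'a, 'm) module_scheme \<Rightarrow> ('r, 'b, 'n) module_scheme \<Rightarrow> ('r, 'a \<times> 'b) module" where
  "direct_sum M N =
     \<lparr>carrier = carrier M \<times> carrier N,
      monoid.mult = (\<lambda>_ _. undefined),
      one = undefined,
      zero = (\<zero>\<^bsub>M\<^esub>, \<zero>\<^bsub>N\<^esub>),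
      add = (\<lambda>(x, y) (x', y'). (x \<oplus>\<^bsub>M\<^esub> x', y \<oplus>\<^bsub>N\<^esub> y')),
      smult = (\<lambda>a (x, y). (a \<odot>\<^bsub>M\<^esub> x, a \<odot>\<^bsub>N\<^esub> y))\<rparr>"

definition path_module ::
  "nat \<Rightarrow> (int \<Rightarrow> int \<Rightarrow> ('r, 'b, 'n) module_scheme) \<Rightarrow> (int \<Rightarrow> int \<Rightarrow> ('r, 'b \<times> 'b \<times> 'b) module)"
  where
  "path_module r B i j =
     direct_sum (B i j) (direct_sum (B (i + int r) (j + int r - 1)) (B i j))"

text \<open>The middle coordinate of \<open>D_r\<close> on bidegree \<open>(i, j)\<close> takes values in \<open>B_i^j\<close>, the one of \<open>D_m\<close>
  in bidegree \<open>(i + r - m, j + r - m)\<close>.\<close>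

definition path_diff ::
  "nat \<Rightarrow> (int \<Rightarrow> int \<Rightarrow> ('r, 'b, 'n) module_scheme) \<Rightarrow> (nat \<Rightarrow> int \<Rightarrow> int \<Rightarrow> 'b \<Rightarrow> 'b) \<Rightarrow>
   (nat \<Rightarrow> int \<Rightarrow> int \<Rightarrow> 'b \<times> 'b \<times> 'b \<Rightarrow> 'b \<times> 'b \<times> 'b)" where
  "path_diff r B d m i j = (\<lambda>(x, y, z).
     if m = r then
       (d r i j x,
        (\<ominus>\<^bsub>B i j\<^esub> x) \<ominus>\<^bsub>B i j\<^esub> d r (i + int r) (j + int r - 1) y \<oplus>\<^bsub>B i j\<^esub> z,
        d r i j z)
     else
       (d m i j x,
        signed (B (i + int r - int m) (j + int r - int m)) (int m + int r + 1)
          (d m (i + int r) (j + int r - 1) y),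
        d m i j z))"

text \<open>The strict morphisms \<open>\<partial>\<^sup>-\<close> and \<open>\<partial>\<^sup>+\<close> from the \<open>r\<close>-path of \<open>B\<close> to \<open>B\<close>.\<close>

definition path_minus ::
  "(int \<Rightarrow> int \<Rightarrow> ('r, 'b, 'n) module_scheme) \<Rightarrow> (nat \<Rightarrow> int \<Rightarrow> int \<Rightarrow> 'b \<times> 'b \<times> 'b \<Rightarrow> 'b)" where
  "path_minus B m i j = (\<lambda>(x, y, z). if m = 0 then x else \<zero>\<^bsub>B (i - int m) (j - int m)\<^esub>)"

definition path_plus ::
  "(int \<Rightarrow> int \<Rightarrow> ('r, 'b, 'n) module_scheme) \<Rightarrow> (nat \<Rightarrow> int \<Rightarrow> int \<Rightarrow> 'b \<times> 'b \<times> 'b \<Rightarrow> 'b)" where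
  "path_plus B m i j = (\<lambda>(x, y, z). if m = 0 then z else \<zero>\<^bsub>B (i - int m) (j - int m)\<^esub>)"

definition r_homotopy ::
  "('r, 'k) ring_scheme \<Rightarrow> nat \<Rightarrow>
   (int \<Rightarrow> int \<Rightarrow> ('r, 'a, 'm) module_scheme) \<Rightarrow> (nat \<Rightarrow> int \<Rightarrow> int \<Rightarrow> 'a \<Rightarrow> 'a) \<Rightarrow>
   (int \<Rightarrow> int \<Rightarrow> ('r, 'b, 'n) module_scheme) \<Rightarrow> (nat \<Rightarrow> int \<Rightarrow> int \<Rightarrow> 'b \<Rightarrow> 'b) \<Rightarrow>
   (nat \<Rightarrow> int \<Rightarrow> int \<Rightarrow> 'a \<Rightarrow> 'b) \<Rightarrow> (nat \<Rightarrow> int \<Rightarrow> int \<Rightarrow> 'a \<Rightarrow> 'b) \<Rightarrow>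
   (nat \<Rightarrow> int \<Rightarrow> int \<Rightarrow> 'a \<Rightarrow> 'b \<times> 'b \<times> 'b) \<Rightarrow> bool" where
  "r_homotopy R r A dA B dB f g h \<longleftrightarrow>
     twisted_morphism R A dA (path_module r B) (path_diff r B dB) h \<and>
     family_eq A (twisted_comp B (path_minus B) h) f \<and>
     family_eq A (twisted_comp B (path_plus B) h) g"


section \<open>Coalgebras over the Koszul dual of the dual numbers\<close>

text \<open>A coalgebra is a pair \<open>(C, fC)\<close> with \<open>fC : C \<rightarrow> C\<close> linear of bidegree \<open>(1, 1)\<close>; \<open>h\<close> is a map of
  coalgebras of bidegree \<open>(u, v)\<close> if \<open>fD h = (-1)^(u + v) h fC\<close>.\<close>

definition dual_coalgebra ::
  "('r, 'k) ring_scheme \<Rightarrow> (int \<Rightarrow> int \<Rightarrow> ('r, 'c, 'm) module_scheme) \<Rightarrow>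
   (int \<Rightarrow> int \<Rightarrow> 'c \<Rightarrow> 'c) \<Rightarrow> bool" where
  "dual_coalgebra R C fC \<longleftrightarrow> bigraded_module R C \<and> bigraded_map R 1 1 C C fC"

definition coalgebra_map ::
  "('r, 'k) ring_scheme \<Rightarrow> int \<Rightarrow> int \<Rightarrow>
   (int \<Rightarrow> int \<Rightarrow> ('r, 'c, 'm) module_scheme) \<Rightarrow> (int \<Rightarrow> int \<Rightarrow> 'c \<Rightarrow> 'c) \<Rightarrow>
   (int \<Rightarrow> int \<Rightarrow> ('r, 'd, 'n) module_scheme) \<Rightarrow> (int \<Rightarrow> int \<Rightarrow> 'd \<Rightarrow> 'd) \<Rightarrow>
   (int \<Rightarrow> int \<Rightarrow> 'c \<Rightarrow> 'd) \<Rightarrow> bool" where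
  "coalgebra_map R u v C fC D fD h \<longleftrightarrow>
     bigraded_map R u v C D h \<and>
     (\<forall>i j. \<forall>c\<in>carrier (C i j).
        bicomp u v fD h i j c =
        signed (D (i + u + 1) (j + v + 1)) (u + v) (bicomp 1 1 h fC i j c))"

text \<open>
  The cofree coalgebra \<open>R[x] \<otimes> A\<close>, where \<open>x\<close> has bidegree \<open>(-1, -1)\<close>. As \<open>R[x]\<close> is free on the powers
  of \<open>x\<close>, the component of \<open>R[x] \<otimes> A\<close> in bidegree \<open>(i, j)\<close> is the direct sum over \<open>n\<close> of the
  modules \<open>R x^n \<otimes> A_(i+n)^(j+n)\<close>, each a copy of \<open>A_(i+n)^(j+n)\<close>. The element \<open>\<Sum>n. x^n \<otimes> c_n\<close> is
  encoded as the finitely supported sequence \<open>c\<close>.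
\<close>

definition cofree ::
  "(int \<Rightarrow> int \<Rightarrow> ('r, 'a, 'm) module_scheme) \<Rightarrow> (int \<Rightarrow> int \<Rightarrow> ('r, nat \<Rightarrow> 'a) module)" where
  "cofree A i j =
     \<lparr>carrier = {c. (\<forall>n. c n \<in> carrier (A (i + int n) (j + int n))) \<and>
                    finite {n. c n \<noteq> \<zero>\<^bsub>A (i + int n) (j + int n)\<^esub>}},
      monoid.mult = (\<lambda>_ _. undefined),
      one = undefined,
      zero = (\<lambda>n. \<zero>\<^bsub>A (i + int n) (j + int n)\<^esub>),
      add = (\<lambda>c c' n. c n \<oplus>\<^bsub>A (i + int n) (j + int n)\<^esub> c' n),
      smult = (\<lambda>a c n. a \<odot>\<^bsub>A (i + int n) (j + int n)\<^esub> c n)\<rparr>"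

text \<open>The element \<open>x^n \<otimes> a\<close> in bidegree \<open>(i, j)\<close>, for \<open>a \<in> A_(i+n)^(j+n)\<close>.\<close>

definition cofree_monom ::
  "(int \<Rightarrow> int \<Rightarrow> ('r, 'a, 'm) module_scheme) \<Rightarrow> int \<Rightarrow> int \<Rightarrow> nat \<Rightarrow> 'a \<Rightarrow> (nat \<Rightarrow> 'a)" where
  "cofree_monom A i j n a = (\<lambda>k. if k = n then a else \<zero>\<^bsub>A (i + int k) (j + int k)\<^esub>)"

text \<open>\<open>x^(n+1) \<otimes> a \<mapsto> x^n \<otimes> a\<close> and \<open>x^0 \<otimes> a \<mapsto> 0\<close>.\<close>

definition cofree_dx :: "int \<Rightarrow> int \<Rightarrow> (nat \<Rightarrow> 'a) \<Rightarrow> (nat \<Rightarrow> 'a)" where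
  "cofree_dx i j c = (\<lambda>n. c (Suc n))"

text \<open>
  The map between cofree coalgebras that corresponds to a family \<open>f n : A \<rightarrow> B\<close> of bidegrees
  \<open>(u - n, v - n)\<close>: the linear extension of
  \<open>x^n \<otimes> a \<mapsto> \<Sum>k\<le>n. (-1)^(k (u + v)) x^k \<otimes> f (n - k) a\<close>. The coefficient of \<open>x^k\<close> in the
  image of \<open>\<Sum>n. x^n \<otimes> c_n\<close> collects the contributions of the \<open>n \<ge> k\<close>; restricting to the support of
  \<open>c\<close> keeps that sum finite.
\<close>

definition cofree_lift ::
  "int \<Rightarrow> int \<Rightarrow> (int \<Rightarrow> int \<Rightarrow> ('r, 'a, 'm) module_scheme) \<Rightarrow>
   (int \<Rightarrow> int \<Rightarrow> ('r, 'b, 'n) module_scheme) \<Rightarrow> (nat \<Rightarrow> int \<Rightarrow> int \<Rightarrow> 'a \<Rightarrow> 'b) \<Rightarrow>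
   (int \<Rightarrow> int \<Rightarrow> (nat \<Rightarrow> 'a) \<Rightarrow> (nat \<Rightarrow> 'b))" where
  "cofree_lift u v A B f i j c = (\<lambda>k.
     \<Oplus>\<^bsub>B (i + u + int k) (j + v + int k)\<^esub>n\<in>{n. k \<le> n \<and> c n \<noteq> \<zero>\<^bsub>A (i + int n) (j + int n)\<^esub>}.
       signed (B (i + u + int k) (j + v + int k)) (int k * (u + v))
         (f (n - k) (i + int n) (j + int n) (c n)))"

text \<open>The coderivation of bidegree \<open>(0, 1)\<close> encoding the twisted complex \<open>(A, d)\<close>.\<close>

definition cofree_coder ::
  "(int \<Rightarrow> int \<Rightarrow> ('r, 'a, 'm) module_scheme) \<Rightarrow> (nat \<Rightarrow> int \<Rightarrow> int \<Rightarrow> 'a \<Rightarrow> 'a) \<Rightarrow>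
   (int \<Rightarrow> int \<Rightarrow> (nat \<Rightarrow> 'a) \<Rightarrow> (nat \<Rightarrow> 'a))" where
  "cofree_coder A d = cofree_lift 0 1 A A d"

text \<open>The shift \<open>F \<mapsto> F d_x\<close> on maps of cofree coalgebras; it raises the bidegree by \<open>(1, 1)\<close>.\<close>

definition cofree_shift ::
  "(int \<Rightarrow> int \<Rightarrow> (nat \<Rightarrow> 'a) \<Rightarrow> (nat \<Rightarrow> 'b)) \<Rightarrow> (int \<Rightarrow> int \<Rightarrow> (nat \<Rightarrow> 'a) \<Rightarrow> (nat \<Rightarrow> 'b))" where
  "cofree_shift F = bicomp 1 1 F cofree_dx"


section \<open>Compatibility checks\<close>

lemma module_direct_sum:
  assumes "module R M" "module R N"
  shows "module R (direct_sum M N)"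
proof -
  interpret M: module R M by fact
  interpret N: module R N by fact
  show ?thesis
  proof (rule moduleI)
    show "cring R" by (rule M.R.is_cring)
    show "abelian_group (direct_sum M N)"
    proof (rule abelian_groupI)
      fix x assume "x \<in> carrier (direct_sum M N)"
      then have "(\<ominus>\<^bsub>M\<^esub> fst x, \<ominus>\<^bsub>N\<^esub> snd x) \<in> carrier (direct_sum M N)"
        "(\<ominus>\<^bsub>M\<^esub> fst x, \<ominus>\<^bsub>N\<^esub> snd x) \<oplus>\<^bsub>direct_sum M N\<^esub> x = \<zero>\<^bsub>direct_sum M N\<^esub>"
        by (auto simp: direct_sum_def M.l_neg N.l_neg)
      then show "\<exists>y\<in>carrier (direct_sum M N). y \<oplus>\<^bsub>direct_sum M N\<^esub> x = \<zero>\<^bsub>direct_sum M N\<^esub>" by blast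
    qed (auto simp: direct_sum_def M.a_ac N.a_ac)
  qed (auto simp: direct_sum_def M.smult_l_distr N.smult_l_distr M.smult_r_distr N.smult_r_distr
        M.smult_assoc1 N.smult_assoc1)
qed

lemma bigraded_module_path:
  assumes "bigraded_module R B"
  shows "bigraded_module R (path_module r B)"
  using assms by (auto simp: bigraded_module_def path_module_def intro!: module_direct_sum)

lemma bigraded_module_cofree:
  assumes "bigraded_module R A"
  shows "bigraded_module R (cofree A)"
  unfolding bigraded_module_def
proof (intro allI)
  fix i j
  define N where "N n = A (i + int n) (j + int n)" for n
  have N: "module R (N n)" for n
    using assms by (simp add: N_def bigraded_module_def)
  interpret N: module R "N n" for n by (rule N)
  define C where "C = cofree A i j"
  have carr: "carrier C = {c. (\<forall>n. c n \<in> carrier (N n)) \<and> finite {n. c n \<noteq> \<zero>\<^bsub>N n\<^esub>}}"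
    and zero: "\<zero>\<^bsub>C\<^esub> = (\<lambda>n. \<zero>\<^bsub>N n\<^esub>)"
    and add: "\<And>c c'. c \<oplus>\<^bsub>C\<^esub> c' = (\<lambda>n. c n \<oplus>\<^bsub>N n\<^esub> c' n)"
    and smult: "\<And>a c. a \<odot>\<^bsub>C\<^esub> c = (\<lambda>n. a \<odot>\<^bsub>N n\<^esub> c n)"
    by (simp_all add: C_def N_def cofree_def)
  have fin2: "finite {n. c n \<oplus>\<^bsub>N n\<^esub> c' n \<noteq> \<zero>\<^bsub>N n\<^esub>}"
    if "finite {n. c n \<noteq> \<zero>\<^bsub>N n\<^esub>}" "finite {n. c' n \<noteq> \<zero>\<^bsub>N n\<^esub>}" for c c'
    by (rule finite_subset[OF _ finite_UnI[OF that]]) auto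
  have fin1: "finite {n. a \<odot>\<^bsub>N n\<^esub> c n \<noteq> \<zero>\<^bsub>N n\<^esub>}"
    if "finite {n. c n \<noteq> \<zero>\<^bsub>N n\<^esub>}" "a \<in> carrier R" for a c
    by (rule finite_subset[OF _ that(1)]) (use that(2) in \<open>auto simp: N.smult_r_null\<close>)
  have finm: "finite {n. \<ominus>\<^bsub>N n\<^esub> c n \<noteq> \<zero>\<^bsub>N n\<^esub>}"
    if "finite {n. c n \<noteq> \<zero>\<^bsub>N n\<^esub>}" for c
    by (rule finite_subset[OF _ that]) auto
  have "module R C"
  proof (rule moduleI)
    show "cring R" by (rule N.R.is_cring)
    show "abelian_group C"
    proof (rule abelian_groupI)
      fix c assume "c \<in> carrier C"
      then have "(\<lambda>n. \<ominus>\<^bsub>N n\<^esub> c n) \<in> carrier C" "(\<lambda>n. \<ominus>\<^bsub>N n\<^esub> c n) \<oplus>\<^bsub>C\<^esub> c = \<zero>\<^bsub>C\<^esub>"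
        using finm by (auto simp: carr add zero N.l_neg)
      then show "\<exists>y\<in>carrier C. y \<oplus>\<^bsub>C\<^esub> c = \<zero>\<^bsub>C\<^esub>" by blast
    qed (auto simp: carr add zero fin2 N.a_ac)
  qed (auto simp: carr add smult fin1 N.smult_l_distr N.smult_r_distr N.smult_assoc1)
  then show "module R (cofree A i j)" by (simp add: C_def)
qed

lemma dual_coalgebra_cofree:
  assumes "bigraded_module R A"
  shows "dual_coalgebra R (cofree A) cofree_dx"
proof -
  have "finite {n. c (Suc n) \<noteq> \<zero>\<^bsub>A (i + 1 + int n) (j + 1 + int n)\<^esub>}"
    if "finite {n. c n \<noteq> \<zero>\<^bsub>A (i + int n) (j + int n)\<^esub>}" for c i j
    using finite_vimageI[OF that, of Suc] by (simp add: vimage_def algebra_simps)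
  moreover have "c (Suc n) \<in> carrier (A (i + 1 + int n) (j + 1 + int n))"
    if "\<forall>n. c n \<in> carrier (A (i + int n) (j + int n))" for c n i j
    using that[rule_format, of "Suc n"] by (simp add: algebra_simps)
  ultimately show ?thesis
    using bigraded_module_cofree[OF assms]
    by (auto simp: dual_coalgebra_def bigraded_map_def linear_hom_def cofree_def cofree_dx_def
        algebra_simps)
qed

lemma cofree_lift_monom:
  assumes B: "bigraded_module R B"
    and f: "\<And>n. bigraded_map R (u - int n) (v - int n) A B (f n)"
    and A: "bigraded_module R A"
    and a: "a \<in> carrier (A (i + int n) (j + int n))"
  shows "cofree_lift u v A B f i j (cofree_monom A i j n a) =
    (\<lambda>k. if k \<le> n then signed (B (i + u + int k) (j + v + int k)) (int k * (u + v))
                         (f (n - k) (i + int n) (j + int n) a)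
         else \<zero>\<^bsub>B (i + u + int k) (j + v + int k)\<^esub>)"
proof
  fix k
  define M where "M = B (i + u + int k) (j + v + int k)"
  define N where "N = A (i + int n) (j + int n)"
  interpret M: module R M using B by (simp add: M_def bigraded_module_def)
  interpret N: module R N using A by (simp add: N_def bigraded_module_def)
  have lin: "linear_hom R N M (f (n - k) (i + int n) (j + int n))" if "k \<le> n"
    using f[of "n - k", unfolded bigraded_map_def, rule_format, of "i + int n" "j + int n"] that
    by (simp add: N_def M_def of_nat_diff algebra_simps)
  show "cofree_lift u v A B f i j (cofree_monom A i j n a) k =
    (if k \<le> n then signed (B (i + u + int k) (j + v + int k)) (int k * (u + v))
                         (f (n - k) (i + int n) (j + int n) a)
         else \<zero>\<^bsub>B (i + u + int k) (j + v + int k)\<^esub>)"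
  proof (cases "k \<le> n \<and> a \<noteq> \<zero>\<^bsub>N\<^esub>")
    case True
    have "{m. k \<le> m \<and> cofree_monom A i j n a m \<noteq> \<zero>\<^bsub>A (i + int m) (j + int m)\<^esub>} = {n}"
      using True by (auto simp: cofree_monom_def N_def)
    moreover have "signed M (int k * (u + v)) (f (n - k) (i + int n) (j + int n) a) \<in> carrier M"
      using lin True a by (auto simp: linear_hom_def signed_def N_def)
    ultimately show ?thesis
      using True by (simp add: cofree_lift_def cofree_monom_def flip: M_def)
  next
    case False
    have e: "{m. k \<le> m \<and> cofree_monom A i j n a m \<noteq> \<zero>\<^bsub>A (i + int m) (j + int m)\<^esub>} = {}"
      using False by (auto simp: cofree_monom_def N_def)
    have "f (n - k) (i + int n) (j + int n) \<zero>\<^bsub>N\<^esub> = \<zero>\<^bsub>M\<^esub>" if "k \<le> n"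
    proof -
      let ?y = "f (n - k) (i + int n) (j + int n) \<zero>\<^bsub>N\<^esub>"
      have "?y \<in> carrier M" "?y \<oplus>\<^bsub>M\<^esub> ?y = ?y"
        using lin[OF that] N.zero_closed N.l_zero unfolding linear_hom_def by fastforce+
      then show ?thesis by (metis M.add.l_cancel_one)
    qed
    moreover have "signed M l \<zero>\<^bsub>M\<^esub> = \<zero>\<^bsub>M\<^esub>" for l by (simp add: signed_def)
    ultimately show ?thesis using False
      by (auto simp: cofree_lift_def e simp flip: M_def N_def)
  qed
qed

text \<open>On families, the shift is \<open>(f_0, f_1, ...) \<mapsto> (0, f_0, f_1, ...)\<close>; \<^const>\<open>cofree_shift\<close> is the
  corresponding operation on coalgebra maps.\<close>

lemma cofree_lift_shift:
  fixes f :: "nat \<Rightarrow> int \<Rightarrow> int \<Rightarrow> 'a \<Rightarrow> 'b"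
  assumes B: "bigraded_module R B"
    and f: "\<And>n. bigraded_map R (u - int n) (v - int n) A B (f n)"
    and c: "c \<in> carrier (cofree A i j)"
  defines "sf \<equiv> (\<lambda>n i j a. case n of 0 \<Rightarrow> \<zero>\<^bsub>B (i + u + 1) (j + v + 1)\<^esub> | Suc n \<Rightarrow> f n i j a)"
  shows "cofree_lift (u + 1) (v + 1) A B sf i j c = cofree_shift (cofree_lift u v A B f) i j c"
proof
  fix k
  define M where "M = B (i + (u + 1) + int k) (j + (v + 1) + int k)"
  interpret M: module R M using B by (simp add: M_def bigraded_module_def)
  define S where "S = {n. k \<le> n \<and> c n \<noteq> \<zero>\<^bsub>A (i + int n) (j + int n)\<^esub>}"
  define T where "T = {n. k \<le> n \<and> c (Suc n) \<noteq> \<zero>\<^bsub>A (i + 1 + int n) (j + 1 + int n)\<^esub>}"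
  define p where "p n = signed M (int k * (u + 1 + (v + 1))) (sf (n - k) (i + int n) (j + int n) (c n))" for n
  have cn: "c n \<in> carrier (A (i + int n) (j + int n))" for n
    using c by (simp add: cofree_def)
  have finS: "finite S"
    using c by (auto simp: cofree_def S_def)
  have ST: "Suc ` T = S - {k}"
  proof -
    have "n \<in> Suc ` T" if "n \<in> S - {k}" for n
      using that by (cases n) (auto simp: S_def T_def algebra_simps)
    then show ?thesis by (auto simp: S_def T_def algebra_simps)
  qed
  have "sf (k - k) (i + int k) (j + int k) (c k) = \<zero>\<^bsub>M\<^esub>"
    by (simp add: sf_def M_def algebra_simps)
  then have pk: "p k = \<zero>\<^bsub>M\<^esub>"
    by (simp add: p_def signed_def)
  have p_Suc: "p (Suc n) = signed M (int k * (u + v))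
      (f (n - k) (i + 1 + int n) (j + 1 + int n) (c (Suc n)))" if "k \<le> n" for n
    using that by (simp add: p_def sf_def signed_def Suc_diff_le algebra_simps)
  have pcl: "p n \<in> carrier M" if n: "n \<in> S - {k}" for n
  proof -
    from n have "n - k > 0" "k < n" by (auto simp: S_def)
    then obtain l where l: "n - k = Suc l" "int n = int k + 1 + int l" by (cases "n - k") auto
    have "f l (i + int n) (j + int n) (c n) \<in> carrier M"
      using f[of l, unfolded bigraded_map_def, rule_format, of "i + int n" "j + int n"] cn[of n] l(2)
      by (auto simp: linear_hom_def M_def algebra_simps)
    then show ?thesis by (auto simp: p_def sf_def l signed_def)
  qed
  have pcl': "p n \<in> carrier M" if "n \<in> S" for n
    using pcl[of n] pk that by (cases "n = k") auto
  have "cofree_lift (u + 1) (v + 1) A B sf i j c k = finsum M p S"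
    unfolding cofree_lift_def p_def[abs_def] S_def M_def ..
  also have "\<dots> = finsum M p (S - {k})"
    by (rule M.add.finprod_mono_neutral_cong_right) (use finS pk pcl pcl' in auto)
  also have "\<dots> = finsum M (\<lambda>n. p (Suc n)) T"
    unfolding ST[symmetric]
    by (rule M.finsum_reindex) (use pcl ST in auto)
  also have "\<dots> = finsum M (\<lambda>n. signed M (int k * (u + v))
      (f (n - k) (i + 1 + int n) (j + 1 + int n) (c (Suc n)))) T"
  proof (rule M.finsum_cong')
    have "p (Suc n) \<in> carrier M" if "n \<in> T" for n
      using pcl[of "Suc n"] ST that by blast
    then show "(\<lambda>n. signed M (int k * (u + v))
        (f (n - k) (i + 1 + int n) (j + 1 + int n) (c (Suc n)))) \<in> T \<rightarrow> carrier M"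
      using p_Suc by (auto simp: T_def)
  qed (use p_Suc in \<open>auto simp: T_def\<close>)
  also have "\<dots> = cofree_shift (cofree_lift u v A B f) i j c k"
    by (simp add: cofree_shift_def bicomp_def cofree_dx_def cofree_lift_def T_def M_def algebra_simps)
  finally show "cofree_lift (u + 1) (v + 1) A B sf i j c k =
      cofree_shift (cofree_lift u v A B f) i j c k" .
qed

end

theory Submission
  imports Defs
begin

text \<open>
  A morphism \<open>A \<rightarrow> P_r(B)\<close> with ends \<open>f\<close> and \<open>g\<close> has components \<open>(f_m, h_m, g_m)\<close>, and its morphism
  equation holds in the outer coordinates because \<open>f\<close> and \<open>g\<close> are morphisms. Hence an \<open>r\<close>-homotopy is
  a family \<open>h_m\<close> of bidegree \<open>(r - m, r - 1 - m)\<close> satisfying the middle coordinate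
  \<open>\<Sum>k. (-1)^(k+r) d_k h_(m-k) + \<Sum>k. (-1)^k h_k d_(m-k) = g_(m-r) - f_(m-r)\<close> for all \<open>m\<close>, where families
  vanish at negative indices.
  By cofreeness such families correspond to coalgebra maps \<open>H\<close> of bidegree \<open>(r, r - 1)\<close>. Both sides of
  the equation for \<open>H\<close> are coalgebra maps of bidegree \<open>(r, r)\<close>, so they agree as soon as their
  coefficients of \<open>x^0\<close> agree on all \<open>x^m \<otimes> a\<close>, and these coefficients are the two sides of
  that identity.
\<close>

section \<open>Linear and bigraded maps\<close>

lemma linear_homD:
  assumes "linear_hom R M N f"
  shows linear_hom_closed: "x \<in> carrier M \<Longrightarrow> f x \<in> carrier N"
    and linear_hom_add: "x \<in> carrier M \<Longrightarrow> y \<in> carrier M \<Longrightarrow> f (x \<oplus>\<^bsub>M\<^esub> y) = f x \<oplus>\<^bsub>N\<^esub> f y"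
    and linear_hom_smult: "a \<in> carrier R \<Longrightarrow> x \<in> carrier M \<Longrightarrow> f (a \<odot>\<^bsub>M\<^esub> x) = a \<odot>\<^bsub>N\<^esub> f x"
  using assms by (auto simp: linear_hom_def)

lemma linear_hom_zero:
  assumes "module R M" "module R N" "linear_hom R M N f"
  shows "f \<zero>\<^bsub>M\<^esub> = \<zero>\<^bsub>N\<^esub>"
proof -
  interpret M: module R M by fact
  interpret N: module R N by fact
  have "f \<zero>\<^bsub>M\<^esub> \<oplus>\<^bsub>N\<^esub> f \<zero>\<^bsub>M\<^esub> = f \<zero>\<^bsub>M\<^esub>"
    using linear_hom_add[OF assms(3) M.zero_closed M.zero_closed] by simp
  then show ?thesis
    using linear_hom_closed[OF assms(3) M.zero_closed] by simp
qed

lemma signed_closed: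
  assumes "module R M" "x \<in> carrier M"
  shows "signed M k x \<in> carrier M"
proof -
  interpret module R M by fact
  show ?thesis using assms(2) by (simp add: signed_def)
qed

lemma signed_zero:
  assumes "module R M"
  shows "signed M k \<zero>\<^bsub>M\<^esub> = \<zero>\<^bsub>M\<^esub>"
proof -
  interpret module R M by fact
  show ?thesis by (simp add: signed_def)
qed

lemma signed_signed:
  assumes "module R M" "x \<in> carrier M"
  shows "signed M k (signed M l x) = signed M (k + l) x"
proof -
  interpret module R M by fact
  show ?thesis using assms(2) by (simp add: signed_def)
qed

lemma signed_cong: "(even k \<longleftrightarrow> even l) \<Longrightarrow> signed M k x = signed M l x"
  by (simp add: signed_def)

text \<open>Regarding a sign as a linear map lets the general facts on linear maps, such as
  \<open>linear_hom_finsum\<close>, carry signs through sums.\<close>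

lemma linear_hom_signed_self:
  assumes "module R M"
  shows "linear_hom R M M (signed M k)"
proof -
  interpret module R M by fact
  show ?thesis by (auto simp: linear_hom_def signed_def minus_add smult_r_minus)
qed

lemma linear_hom_signed:
  assumes "module R M" "module R N" "linear_hom R M N f" "x \<in> carrier M"
  shows "f (signed M k x) = signed N k (f x)"
proof -
  interpret M: module R M by fact
  interpret N: module R N by fact
  have "f x \<oplus>\<^bsub>N\<^esub> f (\<ominus>\<^bsub>M\<^esub> x) = \<zero>\<^bsub>N\<^esub>"
    using linear_hom_add[OF assms(3), of x "\<ominus>\<^bsub>M\<^esub> x"] assms(4) linear_hom_zero[OF assms(1-3)]
    by (simp add: M.r_neg)
  then have "f (\<ominus>\<^bsub>M\<^esub> x) = \<ominus>\<^bsub>N\<^esub> f x"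
    using linear_hom_closed[OF assms(3)] assms(4) by (metis M.a_inv_closed N.add.inv_equality N.a_comm)
  then show ?thesis by (simp add: signed_def)
qed

lemma linear_hom_comp:
  "linear_hom R M N f \<Longrightarrow> linear_hom R N P g \<Longrightarrow> linear_hom R M P (\<lambda>x. g (f x))"
  by (auto simp: linear_hom_def Pi_def)

lemma linear_hom_add_pointwise:
  assumes "module R N" "linear_hom R M N f" "linear_hom R M N g"
  shows "linear_hom R M N (\<lambda>x. f x \<oplus>\<^bsub>N\<^esub> g x)"
proof -
  interpret N: module R N by fact
  note f = linear_homD[OF assms(2)]
  note g = linear_homD[OF assms(3)]
  show ?thesis
    unfolding linear_hom_def by (auto simp: f g N.a_ac N.smult_r_distr)
qed

lemma linear_hom_finsum:
  assumes M: "module R M" and N: "module R N" and f: "linear_hom R M N f"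
    and S: "finite S" and p: "p \<in> S \<rightarrow> carrier M"
  shows "f (\<Oplus>\<^bsub>M\<^esub>k\<in>S. p k) = (\<Oplus>\<^bsub>N\<^esub>k\<in>S. f (p k))"
proof -
  interpret M: module R M by fact
  interpret N: module R N by fact
  show ?thesis using S p
  proof induction
    case (insert x S)
    then have "p x \<in> carrier M" "p \<in> S \<rightarrow> carrier M" by auto
    moreover from this have "(\<lambda>k. f (p k)) \<in> S \<rightarrow> carrier N"
      by (auto intro: linear_hom_closed[OF f])
    ultimately show ?case
      using insert by (simp add: linear_hom_closed[OF f] linear_hom_add[OF f])
  qed (simp add: linear_hom_zero[OF M N f])
qed

lemma bigraded_moduleD: "bigraded_module R A \<Longrightarrow> module R (A i j)"
  by (simp add: bigraded_module_def)

text \<open>The indices of the target are kept up to equality, as they arise in many arithmetic shapes.\<close>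

lemma bigraded_mapD:
  assumes "bigraded_map R p q A B f" "i' = i + p" "j' = j + q"
  shows "linear_hom R (A i j) (B i' j') (f i j)"
  using assms by (simp add: bigraded_map_def)

lemma bigraded_map_closed:
  assumes "bigraded_map R p q A B f" "x \<in> carrier (A i j)" "i' = i + p" "j' = j + q"
  shows "f i j x \<in> carrier (B i' j')"
  using linear_hom_closed[OF bigraded_mapD[OF assms(1,3,4)] assms(2)] .

lemma bigraded_map_bicomp:
  assumes "bigraded_map R p q A B f" "bigraded_map R p' q' B C g"
  shows "bigraded_map R (p + p') (q + q') A C (bicomp p q g f)"
  unfolding bigraded_map_def
proof (intro allI)
  fix i j
  show "linear_hom R (A i j) (C (i + (p + p')) (j + (q + q'))) (bicomp p q g f i j)"
    unfolding bicomp_def[abs_def]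
    by (rule linear_hom_comp) (use assms in \<open>auto intro!: bigraded_mapD\<close>)
qed

section \<open>Maps of cofree coalgebras\<close>

lemma cofree_carrierD:
  assumes "c \<in> carrier (cofree A i j)"
  shows cofree_coeff_closed: "c n \<in> carrier (A (i + int n) (j + int n))"
    and cofree_finite_support: "finite {n. c n \<noteq> \<zero>\<^bsub>A (i + int n) (j + int n)\<^esub>}"
  using assms by (auto simp: cofree_def)

lemma cofree_add_apply: "(c \<oplus>\<^bsub>cofree A i j\<^esub> c') n = c n \<oplus>\<^bsub>A (i + int n) (j + int n)\<^esub> c' n"
  by (simp add: cofree_def)

lemma cofree_smult_apply: "(a \<odot>\<^bsub>cofree A i j\<^esub> c) n = a \<odot>\<^bsub>A (i + int n) (j + int n)\<^esub> c n"
  by (simp add: cofree_def)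

lemma cofree_zero_apply: "\<zero>\<^bsub>cofree A i j\<^esub> n = \<zero>\<^bsub>A (i + int n) (j + int n)\<^esub>"
  by (simp add: cofree_def)

text \<open>Because reading a coefficient is linear, signs and sums in a cofree coalgebra can be
  computed coefficientwise.\<close>

lemma linear_hom_cofree_coeff:
  "linear_hom R (cofree A i j) (A (i + int n) (j + int n)) (\<lambda>c. c n)"
  by (auto simp: linear_hom_def cofree_add_apply cofree_smult_apply cofree_coeff_closed)

lemma cofree_signed_apply:
  assumes "bigraded_module R A" "c \<in> carrier (cofree A i j)"
  shows "signed (cofree A i j) k c n = signed (A (i + int n) (j + int n)) k (c n)"
  using linear_hom_signed[OF bigraded_moduleD[OF bigraded_module_cofree[OF assms(1)]]
      bigraded_moduleD[OF assms(1)] linear_hom_cofree_coeff assms(2)] .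

lemma cofree_monom_closed:
  assumes "bigraded_module R A" "a \<in> carrier (A (i + int n) (j + int n))"
  shows "cofree_monom A i j n a \<in> carrier (cofree A i j)"
proof -
  have "\<zero>\<^bsub>A i' j'\<^esub> \<in> carrier (A i' j')" for i' j'
    using bigraded_moduleD[OF assms(1), of i' j']
    by (simp add: module_def abelian_group_def abelian_monoid.zero_closed)
  moreover have "finite {m. cofree_monom A i j n a m \<noteq> \<zero>\<^bsub>A (i + int m) (j + int m)\<^esub>}"
    by (rule finite_subset[of _ "{n}"]) (auto simp: cofree_monom_def)
  ultimately show ?thesis using assms(2) by (auto simp: cofree_def cofree_monom_def)
qed

lemma cofree_monom_linear:
  assumes "bigraded_module R A"
  shows "linear_hom R (A (i + int n) (j + int n)) (cofree A i j) (cofree_monom A i j n)"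
proof -
  define N where "N n = A (i + int n) (j + int n)" for n
  have "module R (N n)" for n using assms by (simp add: N_def bigraded_module_def)
  then interpret N: module R "N n" for n .
  show ?thesis
    using cofree_monom_closed[OF assms]
    by (auto simp: linear_hom_def cofree_monom_def fun_eq_iff cofree_add_apply cofree_smult_apply
        simp flip: N_def)
qed

text \<open>Finite support makes every element a finite sum of monomials, which are split off one at
  a time.\<close>

lemma cofree_induct [consumes 2, case_names monom add]:
  assumes A: "bigraded_module R A" and "c \<in> carrier (cofree A i j)"
    and monom: "\<And>n a. a \<in> carrier (A (i + int n) (j + int n)) \<Longrightarrow> P (cofree_monom A i j n a)"
    and add: "\<And>c c'. c \<in> carrier (cofree A i j) \<Longrightarrow> c' \<in> carrier (cofree A i j) \<Longrightarrow> P c \<Longrightarrow> P c' \<Longrightarrow>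
      P (c \<oplus>\<^bsub>cofree A i j\<^esub> c')"
  shows "P c"
proof -
  define N where "N n = A (i + int n) (j + int n)" for n
  have mN: "module R (N n)" for n using A by (simp add: N_def bigraded_module_def)
  interpret N: module R "N n" for n by (rule mN)
  \<comment> \<open>The induction runs over a finite set that merely contains the support, so the
    coefficient removed in a step may already be zero.\<close>
  have *: "P c" if "finite S" "c \<in> carrier (cofree A i j)" "{n. c n \<noteq> \<zero>\<^bsub>N n\<^esub>} \<subseteq> S" for S c
    using that
  proof (induction S arbitrary: c)
    case empty
    \<comment> \<open>The zero element is the monomial x^0 \<otimes> 0, so the monomial case covers
      it.\<close>
    then have "c = cofree_monom A i j 0 \<zero>\<^bsub>N 0\<^esub>"
      by (auto simp: cofree_monom_def fun_eq_iff N_def)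
    with monom[of "\<zero>\<^bsub>N 0\<^esub>" 0] show ?case using N.zero_closed[of 0] by (simp add: N_def)
  next
    case (insert m S)
    define c' where "c' = c(m := \<zero>\<^bsub>N m\<^esub>)"
    have cl: "c n \<in> carrier (N n)" for n
      using cofree_coeff_closed[OF insert.prems(1)] by (simp add: N_def)
    have supp: "{n. c' n \<noteq> \<zero>\<^bsub>N n\<^esub>} \<subseteq> S" using insert.prems(2) by (auto simp: c'_def)
    have c': "c' \<in> carrier (cofree A i j)"
      using cl finite_subset[OF supp insert.hyps(1)] by (auto simp: cofree_def c'_def simp flip: N_def)
    have "c = c' \<oplus>\<^bsub>cofree A i j\<^esub> cofree_monom A i j m (c m)"
      using cl by (auto simp: fun_eq_iff cofree_add_apply cofree_monom_def c'_def simp flip: N_def)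
    then show ?case
      using add[OF c' cofree_monom_closed[OF A] insert.IH[OF c' supp] monom] cl[of m]
      by (metis N_def)
  qed
  show ?thesis
    using *[OF cofree_finite_support[OF assms(2)] assms(2)] by (simp add: N_def)
qed

text \<open>The sequence \<open>\<lambda>n. c (n + k)\<close> is the k-fold iterate of d_x applied
  to \<open>c\<close>, hence the bidegree grows by (k, k). Shifting the index is injective, so the
  support stays finite.\<close>

lemma cofree_drop_closed:
  assumes "c \<in> carrier (cofree A i j)"
  shows "(\<lambda>n. c (n + k)) \<in> carrier (cofree A (i + int k) (j + int k))"
proof -
  have "finite {n. c (n + k) \<noteq> \<zero>\<^bsub>A (i + int k + int n) (j + int k + int n)\<^esub>}"
    using finite_vimageI[OF cofree_finite_support[OF assms], of "\<lambda>n. n + k"]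
    by (simp add: vimage_def inj_on_def algebra_simps)
  moreover have "c (n + k) \<in> carrier (A (i + int k + int n) (j + int k + int n))" for n
    using cofree_coeff_closed[OF assms, of "n + k"] by (simp add: algebra_simps)
  ultimately show ?thesis by (simp add: cofree_def)
qed

lemma cofree_drop_monom:
  "(\<lambda>n. cofree_monom A i j m a (n + k)) =
    (if k \<le> m then cofree_monom A (i + int k) (j + int k) (m - k) a
     else \<zero>\<^bsub>cofree A (i + int k) (j + int k)\<^esub>)"
  by (auto simp: fun_eq_iff cofree_monom_def cofree_zero_apply algebra_simps)

section \<open>Composites, sums and signs of coalgebra maps\<close>

lemma coalgebra_map_bigraded:
  "coalgebra_map R u v C fC D fD \<Phi> \<Longrightarrow> bigraded_map R u v C D \<Phi>"
  by (simp add: coalgebra_map_def)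

lemma coalgebra_map_commute:
  assumes "coalgebra_map R u v C fC D fD \<Phi>" "c \<in> carrier (C i j)"
  shows "fD (i + u) (j + v) (\<Phi> i j c) =
    signed (D (i + u + 1) (j + v + 1)) (u + v) (\<Phi> (i + 1) (j + 1) (fC i j c))"
  using assms by (simp add: coalgebra_map_def bicomp_def)

text \<open>Moving the structure map past \<Psi> and then past \<Phi> collects the exponents u' + v'
  and u + v, which add up to the total degree of the composite. Coderivations are covered as well:
  their rule d f = (-1)^(s+t) f d is the same as f d = (-1)^(s+t) d f.\<close>

lemma coalgebra_map_bicomp:
  assumes E: "bigraded_module R E"
    and fC: "bigraded_map R 1 1 C C fC" and fD: "bigraded_map R 1 1 D D fD"
    and D: "bigraded_module R D"
    and \<Phi>: "coalgebra_map R u v C fC D fD \<Phi>" and \<Psi>: "coalgebra_map R u' v' D fD E fE \<Psi>"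
  shows "coalgebra_map R (u + u') (v + v') C fC E fE (bicomp u v \<Psi> \<Phi>)"
proof -
  note bigraded = coalgebra_map_bigraded[OF \<Phi>] coalgebra_map_bigraded[OF \<Psi>]
  have "fE (i + (u + u')) (j + (v + v')) (\<Psi> (i + u) (j + v) (\<Phi> i j c)) =
      signed (E (i + (u + u') + 1) (j + (v + v') + 1)) (u + u' + (v + v'))
        (\<Psi> (i + 1 + u) (j + 1 + v) (\<Phi> (i + 1) (j + 1) (fC i j c)))"
    if c: "c \<in> carrier (C i j)" for i j c
  proof -
    let ?E = "E (i + (u + u') + 1) (j + (v + v') + 1)" and ?D = "D (i + u + 1) (j + v + 1)"
    note \<Phi>c = bigraded_map_closed[OF bigraded(1) c refl refl]
    have \<Phi>fc: "\<Phi> (i + 1) (j + 1) (fC i j c) \<in> carrier ?D"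
      using bigraded_map_closed[OF fC c refl refl]
      by (rule bigraded_map_closed[OF bigraded(1)]) simp_all
    have \<Psi>: "linear_hom R ?D ?E (\<Psi> (i + u + 1) (j + v + 1))"
      by (rule bigraded_mapD[OF bigraded(2)]) simp_all
    have "fE (i + (u + u')) (j + (v + v')) (\<Psi> (i + u) (j + v) (\<Phi> i j c)) =
        signed ?E (u' + v') (\<Psi> (i + u + 1) (j + v + 1) (fD (i + u) (j + v) (\<Phi> i j c)))"
      using coalgebra_map_commute[OF assms(6) \<Phi>c] by (simp add: ac_simps)
    also have "\<dots> = signed ?E (u' + v' + (u + v))
        (\<Psi> (i + u + 1) (j + v + 1) (\<Phi> (i + 1) (j + 1) (fC i j c)))"
      unfolding coalgebra_map_commute[OF \<Phi> c]
        linear_hom_signed[OF bigraded_moduleD[OF D] bigraded_moduleD[OF E] \<Psi> \<Phi>fc]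
      by (rule signed_signed[OF bigraded_moduleD[OF E] linear_hom_closed[OF \<Psi> \<Phi>fc]])
    finally show ?thesis by (simp add: ac_simps)
  qed
  then show ?thesis
    using bigraded_map_bicomp[OF bigraded] by (simp add: coalgebra_map_def bicomp_def)
qed

text \<open>With \<open>coalgebra_map_signed\<close>, this turns each side of the homotopy equation
  into a single coalgebra map, to which the uniqueness statement \<open>coalgebra_map_eqI\<close>
  applies.\<close>

lemma coalgebra_map_add:
  assumes D: "bigraded_module R D" and fC: "bigraded_map R 1 1 C C fC"
    and fD: "bigraded_map R 1 1 D D fD"
    and \<Phi>: "coalgebra_map R u v C fC D fD \<Phi>" and \<Psi>: "coalgebra_map R u v C fC D fD \<Psi>"
  shows "coalgebra_map R u v C fC D fD (\<lambda>i j c. \<Phi> i j c \<oplus>\<^bsub>D (i + u) (j + v)\<^esub> \<Psi> i j c)"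
proof -
  note bigraded = coalgebra_map_bigraded[OF \<Phi>] coalgebra_map_bigraded[OF \<Psi>]
  have "fD (i + u) (j + v) (\<Phi> i j c \<oplus>\<^bsub>D (i + u) (j + v)\<^esub> \<Psi> i j c) =
      signed (D (i + u + 1) (j + v + 1)) (u + v)
        (\<Phi> (i + 1) (j + 1) (fC i j c) \<oplus>\<^bsub>D (i + 1 + u) (j + 1 + v)\<^esub>
         \<Psi> (i + 1) (j + 1) (fC i j c))"
    if c: "c \<in> carrier (C i j)" for i j c
  proof -
    let ?D = "D (i + u + 1) (j + v + 1)"
    have D1: "D (i + 1 + u) (j + 1 + v) = ?D" by (simp add: ac_simps)
    have fc: "fC i j c \<in> carrier (C (i + 1) (j + 1))"
      by (rule bigraded_map_closed[OF fC c]) simp_all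
    have "fD (i + u) (j + v) (\<Phi> i j c \<oplus>\<^bsub>D (i + u) (j + v)\<^esub> \<Psi> i j c) =
        fD (i + u) (j + v) (\<Phi> i j c) \<oplus>\<^bsub>?D\<^esub> fD (i + u) (j + v) (\<Psi> i j c)"
      by (rule linear_hom_add[OF bigraded_mapD[OF fD]])
        (auto intro!: bigraded_map_closed[OF bigraded(1) c] bigraded_map_closed[OF bigraded(2) c])
    also have "\<dots> = signed ?D (u + v) (\<Phi> (i + 1) (j + 1) (fC i j c) \<oplus>\<^bsub>?D\<^esub>
         \<Psi> (i + 1) (j + 1) (fC i j c))"
      unfolding coalgebra_map_commute[OF \<Phi> c] coalgebra_map_commute[OF \<Psi> c]
      by (rule linear_hom_add[OF linear_hom_signed_self[OF bigraded_moduleD[OF D]], symmetric])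
        (auto intro!: bigraded_map_closed[OF bigraded(1) fc] bigraded_map_closed[OF bigraded(2) fc])
    finally show ?thesis by (simp add: D1)
  qed
  moreover have "bigraded_map R u v C D (\<lambda>i j c. \<Phi> i j c \<oplus>\<^bsub>D (i + u) (j + v)\<^esub> \<Psi> i j c)"
    using bigraded unfolding bigraded_map_def
    by (intro allI linear_hom_add_pointwise[OF bigraded_moduleD[OF D]]) auto
  ultimately show ?thesis by (simp add: coalgebra_map_def bicomp_def)
qed

lemma coalgebra_map_signed:
  assumes D: "bigraded_module R D" and fC: "bigraded_map R 1 1 C C fC"
    and fD: "bigraded_map R 1 1 D D fD"
    and \<Phi>: "coalgebra_map R u v C fC D fD \<Phi>"
  shows "coalgebra_map R u v C fC D fD (\<lambda>i j c. signed (D (i + u) (j + v)) k (\<Phi> i j c))"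
proof -
  note bigraded = coalgebra_map_bigraded[OF \<Phi>]
  have "fD (i + u) (j + v) (signed (D (i + u) (j + v)) k (\<Phi> i j c)) =
      signed (D (i + u + 1) (j + v + 1)) (u + v)
        (signed (D (i + 1 + u) (j + 1 + v)) k (\<Phi> (i + 1) (j + 1) (fC i j c)))"
    if c: "c \<in> carrier (C i j)" for i j c
  proof -
    let ?D = "D (i + u + 1) (j + v + 1)"
    have D1: "D (i + 1 + u) (j + 1 + v) = ?D" by (simp add: ac_simps)
    have fc: "fC i j c \<in> carrier (C (i + 1) (j + 1))"
      by (rule bigraded_map_closed[OF fC c]) simp_all
    have \<Phi>fc: "\<Phi> (i + 1) (j + 1) (fC i j c) \<in> carrier ?D"
      by (rule bigraded_map_closed[OF bigraded fc]) simp_all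
    note m = bigraded_moduleD[OF D]
    have "fD (i + u) (j + v) (signed (D (i + u) (j + v)) k (\<Phi> i j c)) =
        signed ?D k (fD (i + u) (j + v) (\<Phi> i j c))"
      by (rule linear_hom_signed[OF m m bigraded_mapD[OF fD]])
        (auto intro!: bigraded_map_closed[OF bigraded c])
    also have "\<dots> = signed ?D (u + v) (signed ?D k (\<Phi> (i + 1) (j + 1) (fC i j c)))"
      unfolding coalgebra_map_commute[OF \<Phi> c] by (simp only: signed_signed[OF m \<Phi>fc] add.commute[of k])
    finally show ?thesis by (simp add: D1)
  qed
  moreover have "bigraded_map R u v C D (\<lambda>i j c. signed (D (i + u) (j + v)) k (\<Phi> i j c))"
    using bigraded unfolding bigraded_map_def
    by (intro allI linear_hom_comp[OF _ linear_hom_signed_self[OF bigraded_moduleD[OF D]]]) auto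
  ultimately show ?thesis by (simp add: coalgebra_map_def bicomp_def)
qed

text \<open>The coefficient of x^k in an element is the coefficient of x^0 in its k-th image under
  d_x. Each d_x moved from the left of \<Phi> to the right costs (-1)^(u+v).\<close>

lemma coalgebra_map_coeff:
  assumes B: "bigraded_module R B"
    and \<Phi>: "coalgebra_map R u v (cofree A) cofree_dx (cofree B) cofree_dx \<Phi>"
    and c: "c \<in> carrier (cofree A i j)"
  shows "\<Phi> i j c k = signed (B (i + u + int k) (j + v + int k)) (int k * (u + v))
    (\<Phi> (i + int k) (j + int k) (\<lambda>n. c (n + k)) 0)"
  using c
proof (induction k arbitrary: i j c)
  case 0
  then show ?case by (simp add: signed_def)
next
  case (Suc k)
  let ?M = "B (i + u + int (Suc k)) (j + v + int (Suc k))"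
  have dx: "cofree_dx i j c \<in> carrier (cofree A (i + 1) (j + 1))"
    using cofree_drop_closed[OF Suc.prems, of 1] by (simp add: cofree_dx_def)
  have M1: "B (i + u + 1 + int k) (j + v + 1 + int k) = ?M"
      "B (i + 1 + u + int k) (j + 1 + v + int k) = ?M" by (simp_all add: ac_simps)
  have cl: "\<Phi> (i + 1) (j + 1) (cofree_dx i j c) \<in> carrier (cofree B (i + u + 1) (j + v + 1))"
    by (rule bigraded_map_closed[OF coalgebra_map_bigraded[OF \<Phi>] dx]) simp_all
  have "\<Phi> (i + int (Suc k)) (j + int (Suc k)) (\<lambda>n. c (n + Suc k))
      \<in> carrier (cofree B (i + int (Suc k) + u) (j + int (Suc k) + v))"
    by (rule bigraded_map_closed[OF coalgebra_map_bigraded[OF \<Phi>] cofree_drop_closed[OF Suc.prems]]) simp_all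
  from cofree_coeff_closed[OF this, of 0]
  have cl0: "\<Phi> (i + int (Suc k)) (j + int (Suc k)) (\<lambda>n. c (n + Suc k)) 0 \<in> carrier ?M"
    by (simp add: ac_simps)
  have "\<Phi> i j c (Suc k) = cofree_dx (i + u) (j + v) (\<Phi> i j c) k" by (simp add: cofree_dx_def)
  also have "\<dots> = signed ?M (u + v) (\<Phi> (i + 1) (j + 1) (cofree_dx i j c) k)"
    unfolding coalgebra_map_commute[OF \<Phi> Suc.prems] cofree_signed_apply[OF B cl] M1 ..
  also have "\<Phi> (i + 1) (j + 1) (cofree_dx i j c) k = signed ?M (int k * (u + v))
      (\<Phi> (i + int (Suc k)) (j + int (Suc k)) (\<lambda>n. c (n + Suc k)) 0)"
    unfolding Suc.IH[OF dx] M1 by (simp add: cofree_dx_def ac_simps)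
  also have "signed ?M (u + v) \<dots> = signed ?M (int (Suc k) * (u + v))
      (\<Phi> (i + int (Suc k)) (j + int (Suc k)) (\<lambda>n. c (n + Suc k)) 0)"
    unfolding signed_signed[OF bigraded_moduleD[OF B] cl0] by (rule signed_cong) (simp add: algebra_simps)
  finally show ?case .
qed

text \<open>Cofreeness: a coalgebra map into \<open>R[x] \<otimes> B\<close> is determined by its coefficient of \<open>x^0\<close>.\<close>

lemma coalgebra_map_eqI:
  assumes A: "bigraded_module R A" and B: "bigraded_module R B"
    and \<Phi>: "coalgebra_map R u v (cofree A) cofree_dx (cofree B) cofree_dx \<Phi>"
    and \<Psi>: "coalgebra_map R u v (cofree A) cofree_dx (cofree B) cofree_dx \<Psi>"
    and eq: "\<And>i j n a. a \<in> carrier (A (i + int n) (j + int n)) \<Longrightarrow>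
      \<Phi> i j (cofree_monom A i j n a) 0 = \<Psi> i j (cofree_monom A i j n a) 0"
    and c: "c \<in> carrier (cofree A i j)"
  shows "\<Phi> i j c = \<Psi> i j c"
proof
  fix k
  \<comment> \<open>Additivity spreads the agreement from monomials to all elements. The coefficient
    of x^k then reduces to that of x^0 of the k-fold d_x-image.\<close>
  have *: "\<Phi> i j c 0 = \<Psi> i j c 0" if "c \<in> carrier (cofree A i j)" for i j c
    using A that
  proof (induction rule: cofree_induct)
    case (add c c')
    show ?case
      using linear_hom_add[OF bigraded_mapD[OF coalgebra_map_bigraded[OF \<Phi>] refl refl] add(1,2)]
        linear_hom_add[OF bigraded_mapD[OF coalgebra_map_bigraded[OF \<Psi>] refl refl] add(1,2)] add(3,4)
      by (metis cofree_add_apply)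
  qed (rule eq)
  show "\<Phi> i j c k = \<Psi> i j c k"
    unfolding coalgebra_map_coeff[OF B \<Phi> c] coalgebra_map_coeff[OF B \<Psi> c]
      *[OF cofree_drop_closed[OF c]] ..
qed

text \<open>The index set in \<open>cofree_lift\<close> is the support of \<open>c\<close> and so
  varies with \<open>c\<close>. Since the maps \<open>f n\<close> send zero to zero, any larger
  finite set of indices from \<open>k\<close> on gives the same sum; this allows several elements to
  be compared over one index set.\<close>

lemma cofree_lift_coeff:
  assumes A: "bigraded_module R A" and B: "bigraded_module R B"
    and f: "\<And>n. bigraded_map R (u - int n) (v - int n) A B (f n)"
    and c: "c \<in> carrier (cofree A i j)"
    and S: "finite S" "S \<subseteq> {k..}" "\<And>n. k \<le> n \<Longrightarrow> c n \<noteq> \<zero>\<^bsub>A (i + int n) (j + int n)\<^esub> \<Longrightarrow> n \<in> S"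
  shows "cofree_lift u v A B f i j c k =
    (\<Oplus>\<^bsub>B (i + u + int k) (j + v + int k)\<^esub>n\<in>S.
       signed (B (i + u + int k) (j + v + int k)) (int k * (u + v))
         (f (n - k) (i + int n) (j + int n) (c n)))"
proof -
  define M where "M = B (i + u + int k) (j + v + int k)"
  have mM: "module R M" using B by (simp add: M_def bigraded_module_def)
  interpret M: module R M by (rule mM)
  define T where "T = {n. k \<le> n \<and> c n \<noteq> \<zero>\<^bsub>A (i + int n) (j + int n)\<^esub>}"
  define p where "p n = signed M (int k * (u + v)) (f (n - k) (i + int n) (j + int n) (c n))" for n
  have lin: "linear_hom R (A (i + int n) (j + int n)) M (f (n - k) (i + int n) (j + int n))"
    if "n \<in> S" for n
    using that S(2) by (auto simp: M_def intro!: bigraded_mapD[OF f])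
  have TS: "T \<subseteq> S" using S(3) by (auto simp: T_def)
  have pS: "p n \<in> carrier M" if "n \<in> S" for n
    unfolding p_def
    by (rule signed_closed[OF mM linear_hom_closed[OF lin[OF that] cofree_coeff_closed[OF c]]])
  have pT: "p n = \<zero>\<^bsub>M\<^esub>" if "n \<in> S - T" for n
  proof -
    have "c n = \<zero>\<^bsub>A (i + int n) (j + int n)\<^esub>" using that S(2) by (auto simp: T_def)
    then show ?thesis
      using linear_hom_zero[OF bigraded_moduleD[OF A] mM lin[of n]] that
      by (simp add: p_def signed_zero[OF mM])
  qed
  have "cofree_lift u v A B f i j c k = finsum M p T"
    unfolding cofree_lift_def T_def p_def[abs_def] M_def ..
  also have "\<dots> = finsum M p S"
    by (rule M.add.finprod_mono_neutral_cong_left) (use TS pS pT S(1) in auto)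
  finally show ?thesis unfolding p_def[abs_def] M_def .
qed

text \<open>Linearity follows by summing over a common interval of indices. For the commutation
  rule, the coefficient of x^(k+1) at \<open>c\<close> and that of x^k at d_x c are the same sum
  after the index shift n \<mapsto> n + 1, apart from one factor (-1)^(u+v).\<close>

lemma coalgebra_map_lift:
  assumes A: "bigraded_module R A" and B: "bigraded_module R B"
    and f: "\<And>n. bigraded_map R (u - int n) (v - int n) A B (f n)"
  shows "coalgebra_map R u v (cofree A) cofree_dx (cofree B) cofree_dx (cofree_lift u v A B f)"
proof -
  let ?F = "cofree_lift u v A B f"
  have mB: "module R (B i j)" for i j by (rule bigraded_moduleD[OF B])
  have lin: "linear_hom R (A (i + int n) (j + int n)) (B (i + u + int k) (j + v + int k))
      (\<lambda>x. signed (B (i + u + int k) (j + v + int k)) l (f (n - k) (i + int n) (j + int n) x))"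
    if "k \<le> n" for i j k n l
    by (rule linear_hom_comp[OF bigraded_mapD[OF f] linear_hom_signed_self[OF mB]])
      (use that in auto)
  have bound: "\<exists>N. \<forall>n. c n \<noteq> \<zero>\<^bsub>A (i + int n) (j + int n)\<^esub> \<longrightarrow> n < N"
    if "c \<in> carrier (cofree A i j)" for c i j
    using finite_nat_set_iff_bounded[THEN iffD1, OF cofree_finite_support[OF that]] by blast
  have coeff: "?F i j c k = (\<Oplus>\<^bsub>B (i + u + int k) (j + v + int k)\<^esub>n\<in>{k..<N}.
       signed (B (i + u + int k) (j + v + int k)) (int k * (u + v))
         (f (n - k) (i + int n) (j + int n) (c n)))"
    if "c \<in> carrier (cofree A i j)" "\<forall>n. c n \<noteq> \<zero>\<^bsub>A (i + int n) (j + int n)\<^esub> \<longrightarrow> n < N" for c i j k N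
    using that by (intro cofree_lift_coeff[OF A B f]) auto
  have cl: "?F i j c k \<in> carrier (B (i + u + int k) (j + v + int k))"
    if c: "c \<in> carrier (cofree A i j)" for c i j k
  proof -
    interpret M: module R "B (i + u + int k) (j + v + int k)" by (rule mB)
    obtain N where N: "\<forall>n. c n \<noteq> \<zero>\<^bsub>A (i + int n) (j + int n)\<^esub> \<longrightarrow> n < N" using bound[OF c] by blast
    show ?thesis
      unfolding coeff[OF c N]
      by (rule M.finsum_closed) (auto intro!: linear_hom_closed[OF lin] cofree_coeff_closed[OF c])
  qed
  have closed: "?F i j c \<in> carrier (cofree B (i + u) (j + v))"
    if c: "c \<in> carrier (cofree A i j)" for c i j
  proof -
    obtain N where N: "\<forall>n. c n \<noteq> \<zero>\<^bsub>A (i + int n) (j + int n)\<^esub> \<longrightarrow> n < N" using bound[OF c] by blast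
    \<comment> \<open>For k beyond the bound N of the support the interval \<open>{k..<N}\<close> is
      empty; hence the image has finite support too.\<close>
    have "?F i j c k = \<zero>\<^bsub>B (i + u + int k) (j + v + int k)\<^esub>" if "\<not> k < N" for k
    proof -
      interpret M: module R "B (i + u + int k) (j + v + int k)" by (rule mB)
      show ?thesis using that by (simp add: coeff[OF c N])
    qed
    then have "{k. ?F i j c k \<noteq> \<zero>\<^bsub>B (i + u + int k) (j + v + int k)\<^esub>} \<subseteq> {..<N}"
      by blast
    then have "finite {k. ?F i j c k \<noteq> \<zero>\<^bsub>B (i + u + int k) (j + v + int k)\<^esub>}"
      using finite_subset by blast
    then show ?thesis using cl[OF c] by (simp add: cofree_def)
  qed
  have "linear_hom R (cofree A i j) (cofree B (i + u) (j + v)) (?F i j)" for i j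
    unfolding linear_hom_def
  proof (intro conjI ballI)
    show "?F i j \<in> carrier (cofree A i j) \<rightarrow> carrier (cofree B (i + u) (j + v))"
      using closed by auto
  next
    fix c c' assume c: "c \<in> carrier (cofree A i j)" and c': "c' \<in> carrier (cofree A i j)"
    interpret CA: module R "cofree A i j"
      by (rule bigraded_moduleD[OF bigraded_module_cofree[OF A]])
    have cc: "c \<oplus>\<^bsub>cofree A i j\<^esub> c' \<in> carrier (cofree A i j)" using c c' by (rule CA.a_closed)
    obtain N1 N2 N3 where N: "\<forall>n. c n \<noteq> \<zero>\<^bsub>A (i + int n) (j + int n)\<^esub> \<longrightarrow> n < N1"
      "\<forall>n. c' n \<noteq> \<zero>\<^bsub>A (i + int n) (j + int n)\<^esub> \<longrightarrow> n < N2"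
      "\<forall>n. (c \<oplus>\<^bsub>cofree A i j\<^esub> c') n \<noteq> \<zero>\<^bsub>A (i + int n) (j + int n)\<^esub> \<longrightarrow> n < N3"
      using bound[OF c] bound[OF c'] bound[OF cc] by blast
    \<comment> \<open>One bound for both summands and their sum, so that all three coefficients
      become sums over the same interval.\<close>
    define N where "N = max N1 (max N2 N3)"
    have N1: "\<forall>n. c n \<noteq> \<zero>\<^bsub>A (i + int n) (j + int n)\<^esub> \<longrightarrow> n < N"
      and N2: "\<forall>n. c' n \<noteq> \<zero>\<^bsub>A (i + int n) (j + int n)\<^esub> \<longrightarrow> n < N"
      and N3: "\<forall>n. (c \<oplus>\<^bsub>cofree A i j\<^esub> c') n \<noteq> \<zero>\<^bsub>A (i + int n) (j + int n)\<^esub> \<longrightarrow> n < N"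
      using N by (auto simp: N_def less_max_iff_disj)
    show "?F i j (c \<oplus>\<^bsub>cofree A i j\<^esub> c') = ?F i j c \<oplus>\<^bsub>cofree B (i + u) (j + v)\<^esub> ?F i j c'"
    proof
      fix k
      interpret M: module R "B (i + u + int k) (j + v + int k)" by (rule mB)
      show "?F i j (c \<oplus>\<^bsub>cofree A i j\<^esub> c') k = (?F i j c \<oplus>\<^bsub>cofree B (i + u) (j + v)\<^esub> ?F i j c') k"
        unfolding cofree_add_apply[of B] coeff[OF c N1] coeff[OF c' N2] coeff[OF cc N3]
        by (subst M.finsum_addf[symmetric])
          (auto simp: cofree_add_apply
            linear_hom_add[OF lin cofree_coeff_closed[OF c] cofree_coeff_closed[OF c']]
            intro!: M.finsum_cong' linear_hom_closed[OF lin] cofree_coeff_closed[OF c]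
              cofree_coeff_closed[OF c'])
    qed
  next
    fix a c assume a: "a \<in> carrier R" and c: "c \<in> carrier (cofree A i j)"
    interpret CA: module R "cofree A i j"
      by (rule bigraded_moduleD[OF bigraded_module_cofree[OF A]])
    have ac: "a \<odot>\<^bsub>cofree A i j\<^esub> c \<in> carrier (cofree A i j)" using a c by (rule CA.smult_closed)
    obtain N1 N2 where N: "\<forall>n. c n \<noteq> \<zero>\<^bsub>A (i + int n) (j + int n)\<^esub> \<longrightarrow> n < N1"
      "\<forall>n. (a \<odot>\<^bsub>cofree A i j\<^esub> c) n \<noteq> \<zero>\<^bsub>A (i + int n) (j + int n)\<^esub> \<longrightarrow> n < N2"
      using bound[OF c] bound[OF ac] by blast
    define N where "N = max N1 N2"
    have N1: "\<forall>n. c n \<noteq> \<zero>\<^bsub>A (i + int n) (j + int n)\<^esub> \<longrightarrow> n < N"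
      and N2: "\<forall>n. (a \<odot>\<^bsub>cofree A i j\<^esub> c) n \<noteq> \<zero>\<^bsub>A (i + int n) (j + int n)\<^esub> \<longrightarrow> n < N"
      using N by (auto simp: N_def less_max_iff_disj)
    show "?F i j (a \<odot>\<^bsub>cofree A i j\<^esub> c) = a \<odot>\<^bsub>cofree B (i + u) (j + v)\<^esub> ?F i j c"
    proof
      fix k
      interpret M: module R "B (i + u + int k) (j + v + int k)" by (rule mB)
      show "?F i j (a \<odot>\<^bsub>cofree A i j\<^esub> c) k = (a \<odot>\<^bsub>cofree B (i + u) (j + v)\<^esub> ?F i j c) k"
        unfolding cofree_smult_apply[of B] coeff[OF c N1] coeff[OF ac N2]
        by (subst M.finsum_smult_ldistr)
          (auto simp: a cofree_smult_apply linear_hom_smult[OF lin a cofree_coeff_closed[OF c]]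
            intro!: M.finsum_cong' linear_hom_closed[OF lin] cofree_coeff_closed[OF c])
    qed
  qed
  moreover have "cofree_dx (i + u) (j + v) (?F i j c) =
      signed (cofree B (i + u + 1) (j + v + 1)) (u + v) (?F (i + 1) (j + 1) (cofree_dx i j c))"
    if c: "c \<in> carrier (cofree A i j)" for i j c
  proof
    fix k
    let ?M = "B (i + u + 1 + int k) (j + v + 1 + int k)"
    have M: "B (i + 1 + u + int k) (j + 1 + v + int k) = ?M"
      "B (i + u + int (Suc k)) (j + v + int (Suc k)) = ?M" by (simp_all add: ac_simps)
    have dx: "cofree_dx i j c \<in> carrier (cofree A (i + 1) (j + 1))"
      using cofree_drop_closed[OF c, of 1] by (simp add: cofree_dx_def)
    have Fdx: "?F (i + 1) (j + 1) (cofree_dx i j c) \<in> carrier (cofree B (i + u + 1) (j + v + 1))"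
      using closed[OF dx] by (simp add: ac_simps)
    obtain N where N: "\<forall>n. c n \<noteq> \<zero>\<^bsub>A (i + int n) (j + int n)\<^esub> \<longrightarrow> n < N" using bound[OF c] by blast
    \<comment> \<open>The bound for \<open>c\<close> is relaxed to \<open>Suc N\<close> while N is
      kept for d_x c: the intervals \<open>{Suc k..<Suc N}\<close> and \<open>{k..<N}\<close> then
      match under \<open>Suc\<close>.\<close>
    then have N': "\<forall>n. c n \<noteq> \<zero>\<^bsub>A (i + int n) (j + int n)\<^esub> \<longrightarrow> n < Suc N"
      using less_SucI by blast
    have Ndx: "\<forall>n. cofree_dx i j c n \<noteq> \<zero>\<^bsub>A (i + 1 + int n) (j + 1 + int n)\<^esub> \<longrightarrow> n < N"
    proof (intro allI impI)
      fix n assume "cofree_dx i j c n \<noteq> \<zero>\<^bsub>A (i + 1 + int n) (j + 1 + int n)\<^esub>"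
      then have "Suc n < N" using N[rule_format, of "Suc n"] by (simp add: cofree_dx_def ac_simps)
      then show "n < N" by simp
    qed
    define p where "p n = f (n - k) (i + 1 + int n) (j + 1 + int n) (c (Suc n))" for n
    have p: "p n \<in> carrier ?M" if "k \<le> n" for n
      unfolding p_def
      by (rule bigraded_map_closed[OF f])
        (use cofree_coeff_closed[OF c, of "Suc n"] that in \<open>simp_all add: ac_simps\<close>)
    interpret M: module R ?M by (rule mB)
    have "cofree_dx (i + u) (j + v) (?F i j c) k = ?F i j c (Suc k)" by (simp add: cofree_dx_def)
    also have "\<dots> = (\<Oplus>\<^bsub>?M\<^esub>n\<in>{Suc k..<Suc N}. signed ?M (int (Suc k) * (u + v))
        (f (n - Suc k) (i + int n) (j + int n) (c n)))"
      unfolding coeff[OF c N'] M ..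
    also have "\<dots> = (\<Oplus>\<^bsub>?M\<^esub>n\<in>Suc ` {k..<N}. signed ?M (int (Suc k) * (u + v))
        (f (n - Suc k) (i + int n) (j + int n) (c n)))"
      by simp
    also have "\<dots> = (\<Oplus>\<^bsub>?M\<^esub>n\<in>{k..<N}. signed ?M (int (Suc k) * (u + v)) (p n))"
    proof -
      have eq: "f (Suc n - Suc k) (i + int (Suc n)) (j + int (Suc n)) (c (Suc n)) = p n" for n
        by (simp add: p_def ac_simps)
      let ?q = "\<lambda>n. signed ?M (int (Suc k) * (u + v)) (f (n - Suc k) (i + int n) (j + int n) (c n))"
      have "?q \<in> Suc ` {k..<N} \<rightarrow> carrier ?M"
        unfolding Pi_def ball_simps using eq p by (auto intro!: signed_closed[OF mB] simp del: of_nat_Suc image_Suc_atLeastLessThan)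
      from M.finsum_reindex[OF this inj_Suc, unfolded eq] show ?thesis .
    qed
    \<comment> \<open>Splitting (k + 1)(u + v) as (u + v) + k (u + v) separates the sign of the
      commutation rule from the sign built into the lift at x^k.\<close>
    also have "\<dots> = (\<Oplus>\<^bsub>?M\<^esub>n\<in>{k..<N}. signed ?M (u + v) (signed ?M (int k * (u + v)) (p n)))"
    proof -
      have "int (Suc k) * (u + v) = u + v + int k * (u + v)" by (simp add: algebra_simps)
      then have eq: "signed ?M (int (Suc k) * (u + v)) (p n) =
          signed ?M (u + v) (signed ?M (int k * (u + v)) (p n))" if "k \<le> n" for n
        using signed_signed[OF mB p[OF that]] by simp
      show ?thesis
        by (rule M.finsum_cong') (use p in \<open>auto simp: eq simp del: of_nat_Suc intro!: signed_closed[OF mB]\<close>)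
    qed
    also have "\<dots> = signed ?M (u + v) (\<Oplus>\<^bsub>?M\<^esub>n\<in>{k..<N}. signed ?M (int k * (u + v)) (p n))"
      by (rule linear_hom_finsum[OF mB mB linear_hom_signed_self[OF mB], symmetric])
        (auto intro!: signed_closed[OF mB] p)
    also have "\<dots> = signed ?M (u + v) (?F (i + 1) (j + 1) (cofree_dx i j c) k)"
      unfolding coeff[OF dx Ndx] M by (simp add: p_def cofree_dx_def)
    also have "\<dots> = signed (cofree B (i + u + 1) (j + v + 1)) (u + v)
        (?F (i + 1) (j + 1) (cofree_dx i j c)) k"
      by (rule cofree_signed_apply[OF B Fdx, symmetric])
    finally show "cofree_dx (i + u) (j + v) (?F i j c) k =
      signed (cofree B (i + u + 1) (j + v + 1)) (u + v) (?F (i + 1) (j + 1) (cofree_dx i j c)) k" .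
  qed
  ultimately show ?thesis by (simp add: coalgebra_map_def bigraded_map_def bicomp_def)
qed

text \<open>The family of a coalgebra map: the inverse of the correspondence \<^const>\<open>cofree_lift\<close>.\<close>

definition cofree_family ::
  "(int \<Rightarrow> int \<Rightarrow> ('r, 'a, 'm) module_scheme) \<Rightarrow> (int \<Rightarrow> int \<Rightarrow> (nat \<Rightarrow> 'a) \<Rightarrow> (nat \<Rightarrow> 'b)) \<Rightarrow>
   (nat \<Rightarrow> int \<Rightarrow> int \<Rightarrow> 'a \<Rightarrow> 'b)" where
  "cofree_family A \<Phi> n i j a =
     \<Phi> (i - int n) (j - int n) (cofree_monom A (i - int n) (j - int n) n a) 0"

text \<open>The component of index n is the composite of three linear maps: a \<mapsto> x^n
  \<otimes> a, then \<Phi>, then the coefficient of x^0.\<close>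

lemma bigraded_map_cofree_family:
  assumes A: "bigraded_module R A"
    and \<Phi>: "coalgebra_map R u v (cofree A) cofree_dx (cofree B) cofree_dx \<Phi>"
  shows "bigraded_map R (u - int n) (v - int n) A B (cofree_family A \<Phi> n)"
  unfolding bigraded_map_def
proof (intro allI)
  fix i j
  have "linear_hom R (A i j) (cofree A (i - int n) (j - int n))
      (cofree_monom A (i - int n) (j - int n) n)"
    using cofree_monom_linear[OF A, of "i - int n" n "j - int n"] by simp
  moreover have "linear_hom R (cofree A (i - int n) (j - int n))
      (cofree B (i + (u - int n)) (j + (v - int n))) (\<Phi> (i - int n) (j - int n))"
    by (rule bigraded_mapD[OF coalgebra_map_bigraded[OF \<Phi>]]) simp_all
  moreover have "linear_hom R (cofree B (i + (u - int n)) (j + (v - int n)))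
      (B (i + (u - int n)) (j + (v - int n))) (\<lambda>c. c 0)"
    using linear_hom_cofree_coeff[of R B "i + (u - int n)" "j + (v - int n)" 0] by simp
  ultimately show "linear_hom R (A i j) (B (i + (u - int n)) (j + (v - int n)))
      (cofree_family A \<Phi> n i j)"
    unfolding cofree_family_def[abs_def] by (rule linear_hom_comp[OF linear_hom_comp])
qed

text \<open>At x^0 the sign (-1)^(k(u+v)) of the lift is trivial, so the family can be read off
  directly.\<close>

lemma cofree_lift_monom_0:
  assumes A: "bigraded_module R A" and B: "bigraded_module R B"
    and f: "\<And>n. bigraded_map R (u - int n) (v - int n) A B (f n)"
    and a: "a \<in> carrier (A (i + int n) (j + int n))"
  shows "cofree_lift u v A B f i j (cofree_monom A i j n a) 0 = f n (i + int n) (j + int n) a"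
  by (simp add: cofree_lift_monom[OF B f A a] signed_def)

text \<open>This is surjectivity of the correspondence: both maps have the same coefficient of x^0
  on every monomial, so cofreeness identifies them.\<close>

lemma cofree_lift_family:
  assumes A: "bigraded_module R A" and B: "bigraded_module R B"
    and \<Phi>: "coalgebra_map R u v (cofree A) cofree_dx (cofree B) cofree_dx \<Phi>"
    and c: "c \<in> carrier (cofree A i j)"
  shows "cofree_lift u v A B (cofree_family A \<Phi>) i j c = \<Phi> i j c"
proof (rule coalgebra_map_eqI[OF A B coalgebra_map_lift[OF A B] \<Phi> _ c])
  note family = bigraded_map_cofree_family[OF A \<Phi>]
  show "bigraded_map R (u - int n) (v - int n) A B (cofree_family A \<Phi> n)" for n
    by (rule family)
  show "cofree_lift u v A B (cofree_family A \<Phi>) i j (cofree_monom A i j n a) 0 =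
      \<Phi> i j (cofree_monom A i j n a) 0" if "a \<in> carrier (A (i + int n) (j + int n))" for i j n a
    unfolding cofree_lift_monom_0[OF A B family that] by (simp add: cofree_family_def)
qed

text \<open>A composite of lifts encodes a signed convolution of families. The inner lift produces
  the terms (-1)^(k(u+v)) x^k \<otimes> f_(m-k)(a), and the outer one sends x^k \<otimes> b to
  g_k(b) at x^0 without a further sign.\<close>

lemma cofree_lift_comp_monom_0:
  assumes A: "bigraded_module R A" and B: "bigraded_module R B" and C: "bigraded_module R C"
    and f: "\<And>n. bigraded_map R (u - int n) (v - int n) A B (f n)"
    and g: "\<And>n. bigraded_map R (u' - int n) (v' - int n) B C (g n)"
    and a: "a \<in> carrier (A (i + int m) (j + int m))"
  shows "bicomp u v (cofree_lift u' v' B C g) (cofree_lift u v A B f) i j (cofree_monom A i j m a) 0 =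
    (\<Oplus>\<^bsub>C (i + u + u') (j + v + v')\<^esub>k\<in>{..m}.
      signed (C (i + u + u') (j + v + v')) (int k * (u + v))
        (g k (i + u + int k) (j + v + int k) (f (m - k) (i + int m) (j + int m) a)))"
proof -
  let ?M = "C (i + u + u') (j + v + v')"
  define e where "e = cofree_lift u v A B f i j (cofree_monom A i j m a)"
  have mB: "module R (B i j)" and mC: "module R (C i j)" for i j
    using B C by (simp_all add: bigraded_module_def)
  interpret M: module R ?M by (rule mC)
  have e_eq: "e k = (if k \<le> m then signed (B (i + u + int k) (j + v + int k)) (int k * (u + v))
      (f (m - k) (i + int m) (j + int m) a) else \<zero>\<^bsub>B (i + u + int k) (j + v + int k)\<^esub>)" for k
    unfolding e_def cofree_lift_monom[OF B f A a] ..
  have e: "e \<in> carrier (cofree B (i + u) (j + v))"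
    unfolding e_def
    by (rule bigraded_map_closed[OF coalgebra_map_bigraded[OF coalgebra_map_lift[OF A B f]]
          cofree_monom_closed[OF A a]]) simp_all
  have fa: "f (m - k) (i + int m) (j + int m) a \<in> carrier (B (i + u + int k) (j + v + int k))"
    if "k \<le> m" for k
    by (rule bigraded_map_closed[OF f a]) (use that in auto)
  have g_lin: "linear_hom R (B (i + u + int k) (j + v + int k)) ?M
      (g k (i + u + int k) (j + v + int k))" for k
    by (rule bigraded_mapD[OF g]) simp_all
  \<comment> \<open>The inner lift does not raise the power of x, so \<open>{..m}\<close> can
    replace the actual support, whichever of the terms f_(m-k)(a) vanish.\<close>
  have supp: "n \<in> {..m}" if "e n \<noteq> \<zero>\<^bsub>B (i + u + int n) (j + v + int n)\<^esub>" for n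
    using that by (auto simp: e_eq split: if_splits)
  have "cofree_lift u' v' B C g (i + u) (j + v) e 0 =
      (\<Oplus>\<^bsub>?M\<^esub>k\<in>{..m}. g k (i + u + int k) (j + v + int k) (e k))"
    using cofree_lift_coeff[OF B C g e, of "{..m}" 0, OF _ _ supp]
    by (simp add: signed_def)
  also have "\<dots> = (\<Oplus>\<^bsub>?M\<^esub>k\<in>{..m}. signed ?M (int k * (u + v))
        (g k (i + u + int k) (j + v + int k) (f (m - k) (i + int m) (j + int m) a)))"
    by (rule M.finsum_cong')
      (auto simp: e_eq linear_hom_signed[OF mB mC g_lin fa] intro!: signed_closed[OF mC]
        linear_hom_closed[OF g_lin] fa)
  finally show ?thesis by (simp add: bicomp_def e_def)
qed

section \<open>Iterated shifts\<close>

lemma cofree_shift_funpow: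
  "(cofree_shift ^^ r) \<Phi> i j c = \<Phi> (i + int r) (j + int r) (\<lambda>n. c (n + r))"
  by (induction r arbitrary: i j c)
    (simp_all add: cofree_shift_def bicomp_def cofree_dx_def ac_simps)

lemma coalgebra_map_shift_funpow:
  assumes A: "bigraded_module R A" and B: "bigraded_module R B"
    and \<Phi>: "coalgebra_map R u v (cofree A) cofree_dx (cofree B) cofree_dx \<Phi>"
  shows "coalgebra_map R (u + int r) (v + int r) (cofree A) cofree_dx (cofree B) cofree_dx
    ((cofree_shift ^^ r) \<Phi>)"
proof (induction r)
  case (Suc r)
  have dx: "bigraded_map R 1 1 (cofree A) (cofree A) cofree_dx"
    using dual_coalgebra_cofree[OF A] by (simp add: dual_coalgebra_def)
  \<comment> \<open>The map d_x commutes with itself and has even total degree 2, so it is a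
    coalgebra map of bidegree (1, 1); a shift is composition with it.\<close>
  have "coalgebra_map R 1 1 (cofree A) cofree_dx (cofree A) cofree_dx cofree_dx"
    using dx by (simp add: coalgebra_map_def bicomp_def signed_def)
  from coalgebra_map_bicomp[OF bigraded_module_cofree[OF B] dx dx bigraded_module_cofree[OF A] this Suc]
  show ?case by (simp add: cofree_shift_def ac_simps)
qed (use \<Phi> in simp)

text \<open>The r-fold d_x turns x^m \<otimes> a into x^(m-r) \<otimes> a, or into zero if m < r.
  The second case realises the convention that families vanish at negative indices.\<close>

lemma cofree_shift_funpow_lift_monom_0:
  assumes A: "bigraded_module R A" and B: "bigraded_module R B"
    and f: "\<And>n. bigraded_map R (- int n) (- int n) A B (f n)"
    and a: "a \<in> carrier (A (i + int m) (j + int m))"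
  shows "(cofree_shift ^^ r) (cofree_lift 0 0 A B f) i j (cofree_monom A i j m a) 0 =
    (if r \<le> m then f (m - r) (i + int m) (j + int m) a else \<zero>\<^bsub>B (i + int r) (j + int r)\<^esub>)"
proof -
  have f0: "bigraded_map R (0 - int n) (0 - int n) A B (f n)" for n using f by simp
  have "linear_hom R (cofree A (i + int r) (j + int r)) (cofree B (i + int r) (j + int r))
      (cofree_lift 0 0 A B f (i + int r) (j + int r))"
    by (rule bigraded_mapD[OF coalgebra_map_bigraded[OF coalgebra_map_lift[OF A B f0]]]) simp_all
  from linear_hom_zero[OF bigraded_moduleD[OF bigraded_module_cofree[OF A]]
      bigraded_moduleD[OF bigraded_module_cofree[OF B]] this]
  have "cofree_lift 0 0 A B f (i + int r) (j + int r) \<zero>\<^bsub>cofree A (i + int r) (j + int r)\<^esub> =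
      \<zero>\<^bsub>cofree B (i + int r) (j + int r)\<^esub>" .
  moreover have "cofree_lift 0 0 A B f (i + int r) (j + int r)
      (cofree_monom A (i + int r) (j + int r) (m - r) a) 0 = f (m - r) (i + int m) (j + int m) a"
    if "r \<le> m"
    using cofree_lift_monom_0[OF A B f0, of a "i + int r" "m - r" "j + int r"] a that
    by simp
  ultimately show ?thesis
    by (simp add: cofree_shift_funpow cofree_drop_monom cofree_zero_apply)
qed

section \<open>Morphisms into a path\<close>

lemma linear_hom_direct_sum_fst: "linear_hom R (direct_sum M N) M fst"
  and linear_hom_direct_sum_snd: "linear_hom R (direct_sum M N) N snd"
  by (auto simp: linear_hom_def direct_sum_def)

lemma linear_hom_path:
  shows linear_hom_path_minus: "linear_hom R (path_module r B i j) (B i j) fst"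
    and linear_hom_path_mid:
      "linear_hom R (path_module r B i j) (B (i + int r) (j + int r - 1)) (\<lambda>p. fst (snd p))"
    and linear_hom_path_plus: "linear_hom R (path_module r B i j) (B i j) (\<lambda>p. snd (snd p))"
  unfolding path_module_def
  by (intro linear_hom_direct_sum_fst linear_hom_comp[OF linear_hom_direct_sum_snd linear_hom_direct_sum_fst]
      linear_hom_comp[OF linear_hom_direct_sum_snd linear_hom_direct_sum_snd])+

lemma path_module_carrier:
  "carrier (path_module r B i j) =
    carrier (B i j) \<times> carrier (B (i + int r) (j + int r - 1)) \<times> carrier (B i j)"
  by (simp add: path_module_def direct_sum_def)

lemma bigraded_map_path:
  assumes "bigraded_map R p q A B f" "bigraded_map R (p + int r) (q + int r - 1) A B h"
    "bigraded_map R p q A B g"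
  shows "bigraded_map R p q A (path_module r B) (\<lambda>i j x. (f i j x, h i j x, g i j x))"
  unfolding bigraded_map_def
proof (intro allI)
  fix i j
  let ?M = "B (i + p) (j + q)" and ?N = "B (i + p + int r) (j + q + int r - 1)"
  have "linear_hom R (A i j) ?M (f i j)" "linear_hom R (A i j) ?N (h i j)"
    "linear_hom R (A i j) ?M (g i j)"
    using assms by (auto intro!: bigraded_mapD)
  then show "linear_hom R (A i j) (path_module r B (i + p) (j + q))
      (\<lambda>x. (f i j x, h i j x, g i j x))"
    by (auto simp: linear_hom_def path_module_def direct_sum_def)
qed

lemma bigraded_map_path_components:
  assumes "bigraded_map R p q A (path_module r B) h"
  shows "bigraded_map R p q A B (\<lambda>i j x. fst (h i j x))"
    and "bigraded_map R (p + int r) (q + int r - 1) A B (\<lambda>i j x. fst (snd (h i j x)))"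
    and "bigraded_map R p q A B (\<lambda>i j x. snd (snd (h i j x)))"
proof -
  have h: "linear_hom R (A i j) (path_module r B (i + p) (j + q)) (h i j)" for i j
    using assms by (simp add: bigraded_map_def)
  show "bigraded_map R p q A B (\<lambda>i j x. fst (h i j x))"
    "bigraded_map R p q A B (\<lambda>i j x. snd (snd (h i j x)))"
    using linear_hom_comp[OF h linear_hom_path_minus] linear_hom_comp[OF h linear_hom_path_plus]
    by (simp_all add: bigraded_map_def)
  show "bigraded_map R (p + int r) (q + int r - 1) A B (\<lambda>i j x. fst (snd (h i j x)))"
    unfolding bigraded_map_def
  proof (intro allI)
    fix i j
    have "B (i + p + int r) (j + q + int r - 1) = B (i + (p + int r)) (j + (q + int r - 1))"
      by (simp add: algebra_simps)
    then show "linear_hom R (A i j) (B (i + (p + int r)) (j + (q + int r - 1)))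
        (\<lambda>x. fst (snd (h i j x)))"
      using linear_hom_comp[OF h[of i j] linear_hom_path_mid] by (simp only:)
  qed
qed

text \<open>The maps \<partial> are strict, so only the summand k = 0 of the composite
  survives.\<close>

lemma twisted_comp_path_ends:
  assumes B: "bigraded_module R B" and h: "\<And>m. bigraded_map R (- int m) (- int m) A (path_module r B) (h m)"
    and x: "x \<in> carrier (A i j)"
  shows "twisted_comp B (path_minus B) h m i j x = fst (h m i j x)"
    and "twisted_comp B (path_plus B) h m i j x = snd (snd (h m i j x))"
proof -
  let ?M = "B (i - int m) (j - int m)"
  interpret M: module R ?M by (rule bigraded_moduleD[OF B])
  have "h m i j x \<in> carrier (path_module r B (i - int m) (j - int m))"
    by (rule bigraded_map_closed[OF h x]) simp_all
  then have cl: "fst (h m i j x) \<in> carrier ?M" "snd (snd (h m i j x)) \<in> carrier ?M"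
    by (auto simp: path_module_carrier)
  have zero: "\<zero>\<^bsub>B (i + - int (m - k) - int k) (j + - int (m - k) - int k)\<^esub> = \<zero>\<^bsub>?M\<^esub>"
    if "k \<le> m" for k
    using that by (simp)
  have "twisted_comp B (path_minus B) h m i j x =
      (\<Oplus>\<^bsub>?M\<^esub>k\<in>{..m}. if 0 = k then fst (h m i j x) else \<zero>\<^bsub>?M\<^esub>)"
    unfolding twisted_comp_def
    by (rule M.finsum_cong') (use cl zero in \<open>auto simp: bicomp_def path_minus_def split: prod.splits\<close>)
  then show "twisted_comp B (path_minus B) h m i j x = fst (h m i j x)"
    using cl M.finsum_singleton[of 0 "{..m}" "\<lambda>_. fst (h m i j x)"] by simp
  have "twisted_comp B (path_plus B) h m i j x =
      (\<Oplus>\<^bsub>?M\<^esub>k\<in>{..m}. if 0 = k then snd (snd (h m i j x)) else \<zero>\<^bsub>?M\<^esub>)"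
    unfolding twisted_comp_def
    by (rule M.finsum_cong') (use cl zero in \<open>auto simp: bicomp_def path_plus_def split: prod.splits\<close>)
  then show "twisted_comp B (path_plus B) h m i j x = snd (snd (h m i j x))"
    using cl M.finsum_singleton[of 0 "{..m}" "\<lambda>_. snd (snd (h m i j x))"] by simp
qed

text \<open>The condition that the middle components of an \<open>r\<close>-homotopy from \<open>f\<close> to \<open>g\<close> satisfy.\<close>

definition homotopy_family ::
  "('r, 'k) ring_scheme \<Rightarrow> nat \<Rightarrow>
   (int \<Rightarrow> int \<Rightarrow> ('r, 'a, 'm) module_scheme) \<Rightarrow> (nat \<Rightarrow> int \<Rightarrow> int \<Rightarrow> 'a \<Rightarrow> 'a) \<Rightarrow>
   (int \<Rightarrow> int \<Rightarrow> ('r, 'b, 'n) module_scheme) \<Rightarrow> (nat \<Rightarrow> int \<Rightarrow> int \<Rightarrow> 'b \<Rightarrow> 'b) \<Rightarrow>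
   (nat \<Rightarrow> int \<Rightarrow> int \<Rightarrow> 'a \<Rightarrow> 'b) \<Rightarrow> (nat \<Rightarrow> int \<Rightarrow> int \<Rightarrow> 'a \<Rightarrow> 'b) \<Rightarrow>
   (nat \<Rightarrow> int \<Rightarrow> int \<Rightarrow> 'a \<Rightarrow> 'b) \<Rightarrow> bool" where
  "homotopy_family R r A dA B dB f g h \<longleftrightarrow>
     (\<forall>m. bigraded_map R (int r - int m) (int r - 1 - int m) A B (h m)) \<and>
     (\<forall>m i j. \<forall>x\<in>carrier (A i j).
        (let M = B (i + int r - int m) (j + int r - int m) in
         (\<Oplus>\<^bsub>M\<^esub>k\<in>{..m}. signed M (int k + int r)
            (dB k (i + int r - int m + int k) (j + int r - 1 - int m + int k) (h (m - k) i j x)))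
         \<oplus>\<^bsub>M\<^esub> (\<Oplus>\<^bsub>M\<^esub>k\<in>{..m}. signed M (int k)
            (h k (i - int m + int k) (j + 1 - int m + int k) (dA (m - k) i j x))) =
         (if r \<le> m then g (m - r) i j x else \<zero>\<^bsub>M\<^esub>) \<ominus>\<^bsub>M\<^esub>
         (if r \<le> m then f (m - r) i j x else \<zero>\<^bsub>M\<^esub>)))"

text \<open>The three projections of the path are linear, hence commute with the sums and signs of
  the morphism equation and split it into coordinates. The outer ones are the morphism equations of
  \<open>f\<close> and \<open>g\<close>; in the middle one, \<open>-x\<close> and \<open>z\<close>
  in D_r supply the difference of \<open>g\<close> and \<open>f\<close>.\<close>

lemma path_morphism_equation_iff:
  fixes B :: "int \<Rightarrow> int \<Rightarrow> ('r, 'b, 'n) module_scheme"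
    and i j :: int and m r :: nat
  assumes A: "bigraded_module R A" and B: "bigraded_module R B"
    and dA: "\<And>m. bigraded_map R (- int m) (1 - int m) A A (dA m)"
    and dB: "\<And>m. bigraded_map R (- int m) (1 - int m) B B (dB m)"
    and f: "\<And>m. bigraded_map R (- int m) (- int m) A B (f m)"
    and g: "\<And>m. bigraded_map R (- int m) (- int m) A B (g m)"
    and h: "\<And>m. bigraded_map R (int r - int m) (int r - 1 - int m) A B (h m)"
    and x: "x \<in> carrier (A i j)"
  defines "H \<equiv> \<lambda>m i j x. (f m i j x, h m i j x, g m i j x)"
    and "P \<equiv> path_module r B (i - int m) (j - int m + 1)"
    and "M \<equiv> B (i - int m) (j - int m + 1)"
    and "N \<equiv> B (i + int r - int m) (j + int r - int m)"
  shows "(\<Oplus>\<^bsub>P\<^esub>k\<in>{..m}. bicomp (- int (m - k)) (- int (m - k)) (path_diff r B dB k) (H (m - k)) i j x) =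
         (\<Oplus>\<^bsub>P\<^esub>k\<in>{..m}. signed P (int k)
            (bicomp (- int (m - k)) (1 - int (m - k)) (H k) (dA (m - k)) i j x)) \<longleftrightarrow>
     (\<Oplus>\<^bsub>M\<^esub>k\<in>{..m}. bicomp (- int (m - k)) (- int (m - k)) (dB k) (f (m - k)) i j x) =
       (\<Oplus>\<^bsub>M\<^esub>k\<in>{..m}. signed M (int k)
            (bicomp (- int (m - k)) (1 - int (m - k)) (f k) (dA (m - k)) i j x)) \<and>
     (\<Oplus>\<^bsub>M\<^esub>k\<in>{..m}. bicomp (- int (m - k)) (- int (m - k)) (dB k) (g (m - k)) i j x) =
       (\<Oplus>\<^bsub>M\<^esub>k\<in>{..m}. signed M (int k)
            (bicomp (- int (m - k)) (1 - int (m - k)) (g k) (dA (m - k)) i j x)) \<and>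
     (\<Oplus>\<^bsub>N\<^esub>k\<in>{..m}. signed N (int k + int r)
            (dB k (i + int r - int m + int k) (j + int r - 1 - int m + int k) (h (m - k) i j x)))
         \<oplus>\<^bsub>N\<^esub> (\<Oplus>\<^bsub>N\<^esub>k\<in>{..m}. signed N (int k)
            (h k (i - int m + int k) (j + 1 - int m + int k) (dA (m - k) i j x))) =
         (if r \<le> m then g (m - r) i j x else \<zero>\<^bsub>N\<^esub>) \<ominus>\<^bsub>N\<^esub>
         (if r \<le> m then f (m - r) i j x else \<zero>\<^bsub>N\<^esub>)"
    (is "?L = ?R \<longleftrightarrow> ?F \<and> ?G \<and> ?E")
proof -
  have mM: "module R M" and mN: "module R N" and mP: "module R P"
    using bigraded_moduleD[OF B] bigraded_moduleD[OF bigraded_module_path[OF B]]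
    by (auto simp: M_def N_def P_def)
  interpret M: module R M by (rule mM)
  interpret N: module R N by (rule mN)
  interpret P: module R P by (rule mP)
  \<comment> \<open>The middle summand of \<open>P\<close> shifts the bidegree (i - m, j - m + 1) by
    (r, r - 1), so the +1 and the -1 cancel.\<close>
  have N_eq: "N = B (i - int m + int r) (j - int m + 1 + int r - 1)"
    by (simp add: N_def algebra_simps)
  have proj: "linear_hom R P M fst" "linear_hom R P N (\<lambda>p. fst (snd p))"
      "linear_hom R P M (\<lambda>p. snd (snd p))"
    unfolding P_def M_def N_eq by (rule linear_hom_path)+
  define pl where "pl k = bicomp (- int (m - k)) (- int (m - k)) (path_diff r B dB k) (H (m - k)) i j x" for k
  define q where "q k = bicomp (- int (m - k)) (1 - int (m - k)) (H k) (dA (m - k)) i j x" for k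
  define X where "X k = signed N (int k + int r)
    (dB k (i + int r - int m + int k) (j + int r - 1 - int m + int k) (h (m - k) i j x))" for k
  define Y where "Y k = h k (i - int m + int k) (j + 1 - int m + int k) (dA (m - k) i j x)" for k
  define W where "W = (if r \<le> m then g (m - r) i j x else \<zero>\<^bsub>N\<^esub>) \<ominus>\<^bsub>N\<^esub>
         (if r \<le> m then f (m - r) i j x else \<zero>\<^bsub>N\<^esub>)"
  have H: "bigraded_map R (- int k) (- int k) A (path_module r B) (H k)" for k
    unfolding H_def by (rule bigraded_map_path) (use f g h[of k] in \<open>simp_all add: algebra_simps\<close>)
  have q_cl: "q k \<in> carrier P" if "k \<le> m" for k
    unfolding q_def bicomp_def P_def
    by (rule bigraded_map_closed[OF H bigraded_map_closed[OF dA x refl refl]])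
      (use that in simp_all)
  have X_cl: "X k \<in> carrier N" if "k \<le> m" for k
    unfolding X_def
    by (rule signed_closed[OF mN], unfold N_def,
        rule bigraded_map_closed[OF dB bigraded_map_closed[OF h x]])
      (use that in simp_all)
  have fg_cl: "f (m - r) i j x \<in> carrier N" "g (m - r) i j x \<in> carrier N" if "r \<le> m"
    unfolding N_def
    by (rule bigraded_map_closed[OF f x] bigraded_map_closed[OF g x]; use that in simp)+
  have W_cl: "W \<in> carrier N" using fg_cl by (simp add: W_def)
  have pl_fst: "fst (pl k) = bicomp (- int (m - k)) (- int (m - k)) (dB k) (f (m - k)) i j x"
    and pl_snd: "snd (snd (pl k)) = bicomp (- int (m - k)) (- int (m - k)) (dB k) (g (m - k)) i j x" for k
    by (auto simp: pl_def H_def bicomp_def path_diff_def)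
  \<comment> \<open>One formula serves all k: the sign (-1)^(k+r+1) in D_k is minus the sign in
    \<open>X k\<close>, which also holds at k = r where the term is -d_r y. The only extra
    contribution, \<open>W\<close>, comes from k = r.\<close>
  have pl_mid: "fst (snd (pl k)) = \<ominus>\<^bsub>N\<^esub> X k \<oplus>\<^bsub>N\<^esub> (if r = k then W else \<zero>\<^bsub>N\<^esub>)" if k: "k \<le> m" for k
  proof -
    define y where "y = dB k (i + int r - int m + int k) (j + int r - 1 - int m + int k) (h (m - k) i j x)"
    have y: "y \<in> carrier N"
      unfolding y_def N_def
      by (rule bigraded_map_closed[OF dB bigraded_map_closed[OF h x]])
        (use k in simp_all)
    have y': "dB k (i + - int (m - k) + int r) (j + - int (m - k) + int r - 1) (h (m - k) i j x) = y"
      using k by (simp add: y_def algebra_simps)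
    show ?thesis
    proof (cases "k = r")
      case True
      have "B (i + - int (m - r)) (j + - int (m - r)) = N"
        using k True by (simp add: N_def algebra_simps)
      then have "fst (snd (pl k)) = (\<ominus>\<^bsub>N\<^esub> f (m - r) i j x) \<ominus>\<^bsub>N\<^esub> y \<oplus>\<^bsub>N\<^esub> g (m - r) i j x"
        using y' by (simp add: pl_def H_def bicomp_def path_diff_def True)
      also have "\<dots> = \<ominus>\<^bsub>N\<^esub> y \<oplus>\<^bsub>N\<^esub> (g (m - r) i j x \<ominus>\<^bsub>N\<^esub> f (m - r) i j x)"
        using y fg_cl k True by (simp add: N.minus_eq N.a_ac)
      finally show ?thesis using k True by (simp add: X_def W_def signed_def y_def)
    next
      case False
      have "B (i + - int (m - k) + int r - int k) (j + - int (m - k) + int r - int k) = N"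
        using k by (simp add: N_def algebra_simps)
      then have "fst (snd (pl k)) = signed N (int k + int r + 1) y"
        using y' False by (simp add: pl_def H_def bicomp_def path_diff_def)
      also have "\<dots> = \<ominus>\<^bsub>N\<^esub> X k"
        using y by (simp add: X_def signed_def y_def)
      finally show ?thesis using False X_cl[OF k] by simp
    qed
  qed
  have pl_cl: "pl k \<in> carrier P" if k: "k \<le> m" for k
  proof -
    have "fst (pl k) \<in> carrier M" "snd (snd (pl k)) \<in> carrier M"
      unfolding pl_fst pl_snd bicomp_def M_def
      by (rule bigraded_map_closed[OF dB bigraded_map_closed[OF f x refl refl]]
          bigraded_map_closed[OF dB bigraded_map_closed[OF g x refl refl]];
          use k in simp)+
    moreover have "fst (snd (pl k)) \<in> carrier N"
      unfolding pl_mid[OF k] using X_cl[OF k] W_cl by simp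
    ultimately show ?thesis
      unfolding P_def path_module_carrier M_def N_eq by (auto simp: mem_Times_iff)
  qed
  have q_mid: "fst (snd (q k)) = Y k" if "k \<le> m" for k
    using that by (simp add: q_def H_def bicomp_def Y_def algebra_simps)
  have Y_cl: "Y k \<in> carrier N" if "k \<le> m" for k
    using linear_hom_closed[OF proj(2) q_cl[OF that]] q_mid[OF that] by simp
  have L: "?L = (\<Oplus>\<^bsub>P\<^esub>k\<in>{..m}. pl k)" and R: "?R = (\<Oplus>\<^bsub>P\<^esub>k\<in>{..m}. signed P (int k) (q k))"
    by (simp_all add: pl_def q_def)
  have pl_Pi: "pl \<in> {..m} \<rightarrow> carrier P"
    and q_Pi: "(\<lambda>k. signed P (int k) (q k)) \<in> {..m} \<rightarrow> carrier P"
    using pl_cl q_cl signed_closed[OF mP] by auto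
  have projL: "\<pi> ?L = (\<Oplus>\<^bsub>Q\<^esub>k\<in>{..m}. \<pi> (pl k))"
    and projR: "\<pi> ?R = (\<Oplus>\<^bsub>Q\<^esub>k\<in>{..m}. signed Q (int k) (\<pi> (q k)))"
    if "linear_hom R P Q \<pi>" "module R Q" for Q :: "('r, 'b, 'n) module_scheme" and \<pi>
  proof -
    interpret Q: module R Q by (rule that)
    show "\<pi> ?L = (\<Oplus>\<^bsub>Q\<^esub>k\<in>{..m}. \<pi> (pl k))"
      unfolding L by (rule linear_hom_finsum[OF mP that(2,1) _ pl_Pi]) simp
    have "\<pi> ?R = (\<Oplus>\<^bsub>Q\<^esub>k\<in>{..m}. \<pi> (signed P (int k) (q k)))"
      unfolding R by (rule linear_hom_finsum[OF mP that(2,1) _ q_Pi]) simp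
    also have "\<dots> = (\<Oplus>\<^bsub>Q\<^esub>k\<in>{..m}. signed Q (int k) (\<pi> (q k)))"
      by (rule Q.finsum_cong')
        (auto simp: linear_hom_signed[OF mP that(2,1) q_cl]
          intro!: signed_closed[OF that(2)] linear_hom_closed[OF that(1)] q_cl)
    finally show "\<pi> ?R = (\<Oplus>\<^bsub>Q\<^esub>k\<in>{..m}. signed Q (int k) (\<pi> (q k)))" .
  qed
  have F: "fst ?L = fst ?R \<longleftrightarrow> ?F"
    unfolding projL[OF proj(1) mM] projR[OF proj(1) mM] pl_fst by (simp add: q_def H_def bicomp_def)
  have G: "snd (snd ?L) = snd (snd ?R) \<longleftrightarrow> ?G"
    unfolding projL[OF proj(3) mM] projR[OF proj(3) mM] pl_snd by (simp add: q_def H_def bicomp_def)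
  define S where "S = (\<Oplus>\<^bsub>N\<^esub>k\<in>{..m}. X k)"
  define T where "T = (\<Oplus>\<^bsub>N\<^esub>k\<in>{..m}. signed N (int k) (Y k))"
  have S_cl: "S \<in> carrier N" and T_cl: "T \<in> carrier N"
    unfolding S_def T_def using X_cl Y_cl
    by (auto intro!: N.finsum_closed signed_closed[OF mN])
  have "(\<Oplus>\<^bsub>N\<^esub>k\<in>{..m}. \<ominus>\<^bsub>N\<^esub> X k) = \<ominus>\<^bsub>N\<^esub> S"
    using linear_hom_finsum[OF mN mN linear_hom_signed_self[OF mN, of 1], of "{..m}" X] X_cl
    by (simp add: S_def signed_def)
  \<comment> \<open>If r > m the index k = r does not occur, and \<open>W\<close> is then the
    difference of two zeros.\<close>
  moreover have "(\<Oplus>\<^bsub>N\<^esub>k\<in>{..m}. if r = k then W else \<zero>\<^bsub>N\<^esub>) = W"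
  proof (cases "r \<le> m")
    case True
    then show ?thesis using W_cl N.finsum_singleton[of r "{..m}" "\<lambda>_. W"] by simp
  next
    case False
    have "(\<Oplus>\<^bsub>N\<^esub>k\<in>{..m}. if r = k then W else \<zero>\<^bsub>N\<^esub>) = (\<Oplus>\<^bsub>N\<^esub>k\<in>{..m}. \<zero>\<^bsub>N\<^esub>)"
      by (rule N.finsum_cong') (use False in auto)
    also have "\<dots> = \<zero>\<^bsub>N\<^esub>" by simp
    also have "\<dots> = W"
      using False N.r_neg[OF N.zero_closed] by (simp only: W_def if_False N.minus_eq)
    finally show ?thesis .
  qed
  moreover have "fst (snd ?L) = (\<Oplus>\<^bsub>N\<^esub>k\<in>{..m}. \<ominus>\<^bsub>N\<^esub> X k \<oplus>\<^bsub>N\<^esub> (if r = k then W else \<zero>\<^bsub>N\<^esub>))"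
    unfolding projL[OF proj(2) mN]
    by (rule N.finsum_cong') (auto simp: pl_mid intro!: X_cl W_cl)
  ultimately have midL: "fst (snd ?L) = \<ominus>\<^bsub>N\<^esub> S \<oplus>\<^bsub>N\<^esub> W"
    using X_cl W_cl by (simp add: Pi_def)
  have midR: "fst (snd ?R) = T"
    unfolding projR[OF proj(2) mN] T_def
    by (rule N.finsum_cong') (auto simp: q_mid intro!: signed_closed[OF mN] Y_cl)
  \<comment> \<open>The middle coordinate reads -S + W = T; moving \<open>S\<close> across gives the
    homotopy identity.\<close>
  have "\<ominus>\<^bsub>N\<^esub> S \<oplus>\<^bsub>N\<^esub> W = T \<longleftrightarrow> S \<oplus>\<^bsub>N\<^esub> T = W"
    using S_cl T_cl W_cl by (metis N.r_neg1 N.r_neg2)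
  then have E: "fst (snd ?L) = fst (snd ?R) \<longleftrightarrow> ?E"
    unfolding midL midR S_def T_def X_def Y_def W_def .
  show ?thesis unfolding F[symmetric] G[symmetric] E[symmetric] by (auto simp: prod_eq_iff)
qed

lemma twisted_morphism_path_iff:
  assumes tA: "twisted_complex R A dA" and tB: "twisted_complex R B dB"
    and f: "\<And>m. bigraded_map R (- int m) (- int m) A B (f m)"
    and g: "\<And>m. bigraded_map R (- int m) (- int m) A B (g m)"
    and h: "\<And>m. bigraded_map R (int r - int m) (int r - 1 - int m) A B (h m)"
  shows "twisted_morphism R A dA (path_module r B) (path_diff r B dB)
      (\<lambda>m i j x. (f m i j x, h m i j x, g m i j x)) \<longleftrightarrow>
    twisted_morphism R A dA B dB f \<and> twisted_morphism R A dA B dB g \<and>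
    homotopy_family R r A dA B dB f g h"
proof -
  have A: "bigraded_module R A" and B: "bigraded_module R B"
    and dA: "\<And>m. bigraded_map R (- int m) (1 - int m) A A (dA m)"
    and dB: "\<And>m. bigraded_map R (- int m) (1 - int m) B B (dB m)"
    using tA tB by (auto simp: twisted_complex_def)
  have H: "bigraded_map R (- int m) (- int m) A (path_module r B)
      (\<lambda>i j x. (f m i j x, h m i j x, g m i j x))" for m
    by (rule bigraded_map_path) (use f g h[of m] in \<open>simp_all add: algebra_simps\<close>)
  show ?thesis
    unfolding twisted_morphism_def homotopy_family_def Let_def
    using f g h H path_morphism_equation_iff[OF A B dA dB f g h] by (simp only: simp_thms) blast
qed

text \<open>The ends of an r-homotopy are prescribed only on carriers. This allows its outer
  components to be exchanged for \<open>f\<close> and \<open>g\<close>.\<close>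

lemma homotopy_family_cong:
  assumes "family_eq A f f'" "family_eq A g g'"
  shows "homotopy_family R r A dA B dB f g h \<longleftrightarrow> homotopy_family R r A dA B dB f' g' h"
  using assms by (simp add: homotopy_family_def family_eq_def Let_def cong: if_cong)

text \<open>Forward, the middle component of a homotopy is extracted; backward, the triple of
  \<open>f\<close>, the family and \<open>g\<close> is a morphism into the path because its outer
  equations hold by hypothesis.\<close>

lemma r_homotopy_iff_homotopy_family:
  assumes tA: "twisted_complex R A dA" and tB: "twisted_complex R B dB"
    and f: "twisted_morphism R A dA B dB f" and g: "twisted_morphism R A dA B dB g"
  shows "(\<exists>h. r_homotopy R r A dA B dB f g h) \<longleftrightarrow> (\<exists>h. homotopy_family R r A dA B dB f g h)"
proof -
  have B: "bigraded_module R B" using tB by (simp add: twisted_complex_def)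
  show ?thesis
  proof
    assume "\<exists>h. r_homotopy R r A dA B dB f g h"
    then obtain H where H: "twisted_morphism R A dA (path_module r B) (path_diff r B dB) H"
      and fH: "family_eq A (twisted_comp B (path_minus B) H) f"
      and gH: "family_eq A (twisted_comp B (path_plus B) H) g"
      by (auto simp: r_homotopy_def)
    have bH: "bigraded_map R (- int m) (- int m) A (path_module r B) (H m)" for m
      using H by (simp add: twisted_morphism_def)
    define f' h' g' where "f' m i j x = fst (H m i j x)" and "h' m i j x = fst (snd (H m i j x))"
      and "g' m i j x = snd (snd (H m i j x))" for m i j x
    have b: "bigraded_map R (- int m) (- int m) A B (f' m)"
      "bigraded_map R (- int m) (- int m) A B (g' m)"
      "bigraded_map R (int r - int m) (int r - 1 - int m) A B (h' m)" for m
      using bigraded_map_path_components[OF bH[of m]]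
      unfolding f'_def[abs_def] g'_def[abs_def] h'_def[abs_def] by (simp_all add: algebra_simps)
    have "homotopy_family R r A dA B dB f' g' h'"
      using H twisted_morphism_path_iff[OF tA tB b] by (simp add: f'_def g'_def h'_def)
    moreover have "family_eq A f' f" "family_eq A g' g"
      using fH gH by (simp_all add: family_eq_def f'_def g'_def twisted_comp_path_ends[OF B bH])
    ultimately show "\<exists>h. homotopy_family R r A dA B dB f g h"
      using homotopy_family_cong by blast
  next
    assume "\<exists>h. homotopy_family R r A dA B dB f g h"
    then obtain h where h: "homotopy_family R r A dA B dB f g h" by blast
    have b: "bigraded_map R (- int m) (- int m) A B (f m)"
      "bigraded_map R (- int m) (- int m) A B (g m)"
      "bigraded_map R (int r - int m) (int r - 1 - int m) A B (h m)" for m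
      using f g h by (simp_all add: twisted_morphism_def homotopy_family_def)
    let ?H = "\<lambda>m i j x. (f m i j x, h m i j x, g m i j x)"
    have H: "twisted_morphism R A dA (path_module r B) (path_diff r B dB) ?H"
      using f g h twisted_morphism_path_iff[OF tA tB b] by simp
    then have bH: "bigraded_map R (- int m) (- int m) A (path_module r B) (?H m)" for m
      by (simp add: twisted_morphism_def)
    have "r_homotopy R r A dA B dB f g ?H"
      using H twisted_comp_path_ends[of R B A r ?H, OF B bH] by (simp add: r_homotopy_def family_eq_def)
    then show "\<exists>h. r_homotopy R r A dA B dB f g h" by blast
  qed
qed

section \<open>The equation on cofree coalgebras\<close>

text \<open>The identity of index m at a is the coefficient of x^0 of the coalgebra equation at x^m
  \<otimes> a. Uniqueness of coalgebra maps extends these coefficients to the full equation.\<close>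

lemma homotopy_family_iff_lift:
  fixes A :: "int \<Rightarrow> int \<Rightarrow> ('r, 'a, 'm) module_scheme"
    and B :: "int \<Rightarrow> int \<Rightarrow> ('r, 'b, 'n) module_scheme"
  assumes A: "bigraded_module R A" and B: "bigraded_module R B"
    and dA: "\<And>m. bigraded_map R (- int m) (1 - int m) A A (dA m)"
    and dB: "\<And>m. bigraded_map R (- int m) (1 - int m) B B (dB m)"
    and f: "\<And>m. bigraded_map R (- int m) (- int m) A B (f m)"
    and g: "\<And>m. bigraded_map R (- int m) (- int m) A B (g m)"
    and h: "\<And>m. bigraded_map R (int r - int m) (int r - 1 - int m) A B (h m)"
  defines "H \<equiv> cofree_lift (int r) (int r - 1) A B h"
    and "F \<equiv> cofree_lift 0 0 A B f" and "G \<equiv> cofree_lift 0 0 A B g"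
  shows "homotopy_family R r A dA B dB f g h \<longleftrightarrow>
    (\<forall>i j. \<forall>c\<in>carrier (cofree A i j).
        signed (cofree B (i + int r) (j + int r)) (int r)
            (bicomp (int r) (int r - 1) (cofree_coder B dB) H i j c)
          \<oplus>\<^bsub>cofree B (i + int r) (j + int r)\<^esub> bicomp 0 1 H (cofree_coder A dA) i j c =
        (cofree_shift ^^ r) G i j c \<ominus>\<^bsub>cofree B (i + int r) (j + int r)\<^esub> (cofree_shift ^^ r) F i j c)"
    (is "_ \<longleftrightarrow> (\<forall>i j. \<forall>c\<in>_. ?lhs i j c = ?rhs i j c)")
proof -
  let ?C = "cofree A" and ?D = "cofree B"
  have mB: "module R (B i j)" for i j using B by (rule bigraded_moduleD)
  note bC = bigraded_module_cofree[OF A] and bD = bigraded_module_cofree[OF B]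
  have dxC: "bigraded_map R 1 1 ?C ?C cofree_dx" and dxD: "bigraded_map R 1 1 ?D ?D cofree_dx"
    using dual_coalgebra_cofree[OF A] dual_coalgebra_cofree[OF B] by (simp_all add: dual_coalgebra_def)
  have dA0: "bigraded_map R (0 - int m) (1 - int m) A A (dA m)"
    and dB0: "bigraded_map R (0 - int m) (1 - int m) B B (dB m)"
    and f0: "bigraded_map R (0 - int m) (0 - int m) A B (f m)"
    and g0: "bigraded_map R (0 - int m) (0 - int m) A B (g m)" for m
    using dA dB f g by simp_all
  note cH = coalgebra_map_lift[OF A B h, folded H_def]
    and cdA = coalgebra_map_lift[OF A A dA0, folded cofree_coder_def]
    and cdB = coalgebra_map_lift[OF B B dB0, folded cofree_coder_def]
    and cF = coalgebra_map_shift_funpow[OF A B coalgebra_map_lift[OF A B f0, folded F_def], of r]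
    and cG = coalgebra_map_shift_funpow[OF A B coalgebra_map_lift[OF A B g0, folded G_def], of r]
  \<comment> \<open>Coderivations are lifts of bidegree (0, 1), so both composites with
    \<open>H\<close> are coalgebra maps of bidegree (r, r).\<close>
  have c1: "coalgebra_map R (int r) (int r) ?C cofree_dx ?D cofree_dx
      (bicomp (int r) (int r - 1) (cofree_coder B dB) H)"
    using coalgebra_map_bicomp[OF bD dxC dxD bD cH cdB] by simp
  have c2: "coalgebra_map R (int r) (int r) ?C cofree_dx ?D cofree_dx
      (bicomp 0 1 H (cofree_coder A dA))"
    using coalgebra_map_bicomp[OF bD dxC dxC bC cdA cH] by simp
  have c_lhs: "coalgebra_map R (int r) (int r) ?C cofree_dx ?D cofree_dx ?lhs"
    by (rule coalgebra_map_add[OF bD dxC dxD coalgebra_map_signed[OF bD dxC dxD c1] c2])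
  have minus: "x \<ominus>\<^bsub>M\<^esub> y = x \<oplus>\<^bsub>M\<^esub> signed M 1 y" for M :: "('r, 'x, 'y) module_scheme" and x y
    by (simp add: a_minus_def signed_def)
  have c_rhs: "coalgebra_map R (int r) (int r) ?C cofree_dx ?D cofree_dx ?rhs"
    unfolding minus
    by (rule coalgebra_map_add[OF bD dxC dxD _ coalgebra_map_signed[OF bD dxC dxD]])
      (use cF cG in simp_all)
  have monom_iff: "?lhs i j (cofree_monom A i j m a) 0 = ?rhs i j (cofree_monom A i j m a) 0 \<longleftrightarrow>
      (let M = B (i + int r) (j + int r) in
         (\<Oplus>\<^bsub>M\<^esub>k\<in>{..m}. signed M (int k + int r)
            (dB k (i + int r + int k) (j + int r - 1 + int k) (h (m - k) (i + int m) (j + int m) a)))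
         \<oplus>\<^bsub>M\<^esub> (\<Oplus>\<^bsub>M\<^esub>k\<in>{..m}. signed M (int k)
            (h k (i + int k) (j + 1 + int k) (dA (m - k) (i + int m) (j + int m) a))) =
         (if r \<le> m then g (m - r) (i + int m) (j + int m) a else \<zero>\<^bsub>M\<^esub>) \<ominus>\<^bsub>M\<^esub>
         (if r \<le> m then f (m - r) (i + int m) (j + int m) a else \<zero>\<^bsub>M\<^esub>))"
    if a: "a \<in> carrier (A (i + int m) (j + int m))" for i j m a
  proof -
    let ?M = "B (i + int r) (j + int r)" and ?e = "cofree_monom A i j m a"
    interpret M: module R ?M by (rule mB)
    have e: "?e \<in> carrier (?C i j)" by (rule cofree_monom_closed[OF A a])
    have cl: "bicomp (int r) (int r - 1) (cofree_coder B dB) H i j ?e \<in> carrier (?D (i + int r) (j + int r))"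
      "(cofree_shift ^^ r) F i j ?e \<in> carrier (?D (i + int r) (j + int r))"
      by (rule bigraded_map_closed[OF coalgebra_map_bigraded[OF c1] e]
          bigraded_map_closed[OF coalgebra_map_bigraded[OF cF] e]; simp)+
    have t: "dB k (i + int r + int k) (j + int r - 1 + int k) (h (m - k) (i + int m) (j + int m) a)
        \<in> carrier ?M" if "k \<le> m" for k
      by (rule bigraded_map_closed[OF dB bigraded_map_closed[OF h a]]) (use that in simp_all)
    have "bicomp (int r) (int r - 1) (cofree_coder B dB) H i j ?e 0 =
        (\<Oplus>\<^bsub>?M\<^esub>k\<in>{..m}. signed ?M (int k * (int r + (int r - 1)))
          (dB k (i + int r + int k) (j + int r - 1 + int k) (h (m - k) (i + int m) (j + int m) a)))"
      using cofree_lift_comp_monom_0[OF A B B h dB0 a]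
      by (simp add: H_def cofree_coder_def add_diff_eq)
    \<comment> \<open>The total degree r + (r - 1) of \<open>H\<close> is odd, so its lift
      contributes exactly (-1)^k. The prefactor (-1)^r then completes the sign (-1)^(k+r).\<close>
    also have "\<dots> = (\<Oplus>\<^bsub>?M\<^esub>k\<in>{..m}. signed ?M (int k)
          (dB k (i + int r + int k) (j + int r - 1 + int k) (h (m - k) (i + int m) (j + int m) a)))"
      by (rule M.finsum_cong') (auto intro!: signed_closed[OF mB] t signed_cong)
    finally have "signed ?M (int r) (bicomp (int r) (int r - 1) (cofree_coder B dB) H i j ?e 0) =
        (\<Oplus>\<^bsub>?M\<^esub>k\<in>{..m}. signed ?M (int r) (signed ?M (int k)
          (dB k (i + int r + int k) (j + int r - 1 + int k) (h (m - k) (i + int m) (j + int m) a))))"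
      using linear_hom_finsum[OF mB mB linear_hom_signed_self[OF mB], of "{..m}" "\<lambda>k. signed ?M (int k)
          (dB k (i + int r + int k) (j + int r - 1 + int k) (h (m - k) (i + int m) (j + int m) a))"]
        signed_closed[OF mB t] by simp
    also have "\<dots> = (\<Oplus>\<^bsub>?M\<^esub>k\<in>{..m}. signed ?M (int k + int r)
          (dB k (i + int r + int k) (j + int r - 1 + int k) (h (m - k) (i + int m) (j + int m) a)))"
      by (rule M.finsum_cong') (auto simp: signed_signed[OF mB t] add.commute[of "int r"] intro!: signed_closed[OF mB] t)
    finally have 1: "signed ?M (int r) (bicomp (int r) (int r - 1) (cofree_coder B dB) H i j ?e 0) = \<dots>" .
    have 2: "bicomp 0 1 H (cofree_coder A dA) i j ?e 0 = (\<Oplus>\<^bsub>?M\<^esub>k\<in>{..m}. signed ?M (int k)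
            (h k (i + int k) (j + 1 + int k) (dA (m - k) (i + int m) (j + int m) a)))"
      using cofree_lift_comp_monom_0[OF A A B dA0 h a] by (simp add: H_def cofree_coder_def)
    note 3 = cofree_shift_funpow_lift_monom_0[OF A B f a, of r, folded F_def]
      and 4 = cofree_shift_funpow_lift_monom_0[OF A B g a, of r, folded G_def]
    have "?lhs i j ?e 0 = signed ?M (int r) (bicomp (int r) (int r - 1) (cofree_coder B dB) H i j ?e 0)
        \<oplus>\<^bsub>?M\<^esub> bicomp 0 1 H (cofree_coder A dA) i j ?e 0"
      using cofree_signed_apply[OF B cl(1), of "int r" 0] by (simp add: cofree_add_apply)
    moreover have "?rhs i j ?e 0 = (cofree_shift ^^ r) G i j ?e 0 \<ominus>\<^bsub>?M\<^esub> (cofree_shift ^^ r) F i j ?e 0"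
      using cofree_signed_apply[OF B cl(2), of 1 0] by (simp add: minus cofree_add_apply)
    ultimately show ?thesis unfolding 1 2 3 4 Let_def by simp
  qed
  have "homotopy_family R r A dA B dB f g h \<longleftrightarrow>
    (\<forall>i j m. \<forall>a\<in>carrier (A (i + int m) (j + int m)).
      ?lhs i j (cofree_monom A i j m a) 0 = ?rhs i j (cofree_monom A i j m a) 0)"
    (is "_ \<longleftrightarrow> ?monoms")
  proof -
    \<comment> \<open>For x^m \<otimes> a to lie in bidegree (i, j), the element a must lie in
      bidegree (i + m, j + m). Translation by m is a bijection on the indices.\<close>
    have reindex: "(\<forall>m i j. \<forall>x\<in>carrier (A i j). Q m i j x) \<longleftrightarrow>
        (\<forall>i j m. \<forall>a\<in>carrier (A (i + int m) (j + int m)). Q m (i + int m) (j + int m) a)" for Q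
      by (metis diff_add_cancel)
    show ?thesis
      unfolding homotopy_family_def reindex using h monom_iff by (simp add: algebra_simps)
  qed
  also have "\<dots> \<longleftrightarrow> (\<forall>i j. \<forall>c\<in>carrier (?C i j). ?lhs i j c = ?rhs i j c)"
  proof
    assume ?monoms
    then show "\<forall>i j. \<forall>c\<in>carrier (?C i j). ?lhs i j c = ?rhs i j c"
      using coalgebra_map_eqI[OF A B c_lhs c_rhs] by blast
  next
    assume "\<forall>i j. \<forall>c\<in>carrier (?C i j). ?lhs i j c = ?rhs i j c"
    then show ?monoms using cofree_monom_closed[OF A] by simp
  qed
  finally show ?thesis .
qed

theorem theorem3p37:
  fixes R :: "('r, 'k) ring_scheme"
    and A :: "int \<Rightarrow> int \<Rightarrow> ('r, 'a, 'm) module_scheme"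
    and B :: "int \<Rightarrow> int \<Rightarrow> ('r, 'b, 'n) module_scheme"
    and dA :: "nat \<Rightarrow> int \<Rightarrow> int \<Rightarrow> 'a \<Rightarrow> 'a"
    and dB :: "nat \<Rightarrow> int \<Rightarrow> int \<Rightarrow> 'b \<Rightarrow> 'b"
    and f g :: "nat \<Rightarrow> int \<Rightarrow> int \<Rightarrow> 'a \<Rightarrow> 'b"
    and r :: nat
  assumes "cring R"
    and "twisted_complex R A dA"
    and "twisted_complex R B dB"
    and "twisted_morphism R A dA B dB f"
    and "twisted_morphism R A dA B dB g"
  shows "(\<exists>h. r_homotopy R r A dA B dB f g h) \<longleftrightarrow>
    (\<exists>H. coalgebra_map R (int r) (int r - 1) (cofree A) cofree_dx (cofree B) cofree_dx H \<and>
      (\<forall>i j. \<forall>c\<in>carrier (cofree A i j).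
        (let M = cofree B (i + int r) (j + int r);
             F = cofree_lift 0 0 A B f;
             G = cofree_lift 0 0 A B g
         in signed M (int r) (bicomp (int r) (int r - 1) (cofree_coder B dB) H i j c)
              \<oplus>\<^bsub>M\<^esub> bicomp 0 1 H (cofree_coder A dA) i j c =
            (cofree_shift ^^ r) G i j c \<ominus>\<^bsub>M\<^esub> (cofree_shift ^^ r) F i j c)))"
proof -
  have A: "bigraded_module R A" and B: "bigraded_module R B"
    and dA: "\<And>m. bigraded_map R (- int m) (1 - int m) A A (dA m)"
    and dB: "\<And>m. bigraded_map R (- int m) (1 - int m) B B (dB m)"
    using assms(2,3) by (auto simp: twisted_complex_def)
  have f: "\<And>m. bigraded_map R (- int m) (- int m) A B (f m)"
    and g: "\<And>m. bigraded_map R (- int m) (- int m) A B (g m)"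
    using assms(4,5) by (auto simp: twisted_morphism_def)
  \<comment> \<open>The equation is treated as a predicate so that it can be tested both at an
    arbitrary \<open>H\<close> and at the lift of a family.\<close>
  define E where "E H \<longleftrightarrow> (\<forall>i j. \<forall>c\<in>carrier (cofree A i j).
        signed (cofree B (i + int r) (j + int r)) (int r)
            (bicomp (int r) (int r - 1) (cofree_coder B dB) H i j c)
          \<oplus>\<^bsub>cofree B (i + int r) (j + int r)\<^esub> bicomp 0 1 H (cofree_coder A dA) i j c =
        (cofree_shift ^^ r) (cofree_lift 0 0 A B g) i j c
          \<ominus>\<^bsub>cofree B (i + int r) (j + int r)\<^esub> (cofree_shift ^^ r) (cofree_lift 0 0 A B f) i j c)" for H
  let ?co = "coalgebra_map R (int r) (int r - 1) (cofree A) cofree_dx (cofree B) cofree_dx"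
  let ?lift = "cofree_lift (int r) (int r - 1) A B"
  have iff: "homotopy_family R r A dA B dB f g h \<longleftrightarrow> E (?lift h)"
    if "\<And>m. bigraded_map R (int r - int m) (int r - 1 - int m) A B (h m)" for h
    using homotopy_family_iff_lift[OF A B dA dB f g that] unfolding E_def .
  have "(\<exists>h. homotopy_family R r A dA B dB f g h) \<longleftrightarrow> (\<exists>H. ?co H \<and> E H)"
  proof
    assume "\<exists>h. homotopy_family R r A dA B dB f g h"
    then obtain h where h: "homotopy_family R r A dA B dB f g h" by blast
    then have b: "bigraded_map R (int r - int m) (int r - 1 - int m) A B (h m)" for m
      by (simp add: homotopy_family_def)
    show "\<exists>H. ?co H \<and> E H"
      using coalgebra_map_lift[OF A B b] iff[OF b] h by blast
  next
    assume "\<exists>H. ?co H \<and> E H"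
    then obtain H where H: "?co H" "E H" by blast
    \<comment> \<open>The witness is the inverse of the correspondence applied to \<open>H\<close>;
      its lift agrees with \<open>H\<close> on carriers, so the equation transfers to the
      lift.\<close>
    let ?h = "cofree_family A H"
    have b: "bigraded_map R (int r - int m) (int r - 1 - int m) A B (?h m)" for m
      by (rule bigraded_map_cofree_family[OF A H(1)])
    have lift: "?lift ?h i j c = H i j c" if "c \<in> carrier (cofree A i j)" for i j c
      by (rule cofree_lift_family[OF A B H(1) that])
    \<comment> \<open>In the second term \<open>H\<close> is evaluated at the image of
      \<open>c\<close> under the coderivation, so that image must lie in the carrier before the lift
      can be replaced by \<open>H\<close>.\<close>
    have coder: "cofree_coder A dA i j c \<in> carrier (cofree A (i + 0) (j + 1))"
      if "c \<in> carrier (cofree A i j)" for i j c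
    proof -
      have "bigraded_map R (0 - int m) (1 - int m) A A (dA m)" for m using dA by simp
      from bigraded_map_closed[OF coalgebra_map_bigraded[OF coalgebra_map_lift[OF A A this]] that refl refl]
      show ?thesis unfolding cofree_coder_def .
    qed
    have "E (?lift ?h)"
      unfolding E_def
    proof (intro allI ballI)
      fix i j c assume c: "c \<in> carrier (cofree A i j)"
      show "signed (cofree B (i + int r) (j + int r)) (int r)
            (bicomp (int r) (int r - 1) (cofree_coder B dB) (?lift ?h) i j c)
          \<oplus>\<^bsub>cofree B (i + int r) (j + int r)\<^esub> bicomp 0 1 (?lift ?h) (cofree_coder A dA) i j c =
        (cofree_shift ^^ r) (cofree_lift 0 0 A B g) i j c
          \<ominus>\<^bsub>cofree B (i + int r) (j + int r)\<^esub> (cofree_shift ^^ r) (cofree_lift 0 0 A B f) i j c"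
        using H(2)[unfolded E_def, rule_format, OF c]
        unfolding bicomp_def lift[OF c] lift[OF coder[OF c]] .
    qed
    then show "\<exists>h. homotopy_family R r A dA B dB f g h"
      using iff[OF b] by blast
  qed
  then show ?thesis
    unfolding r_homotopy_iff_homotopy_family[OF assms(2-5)] E_def Let_def .
qed

end
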